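(* Consider the system $\dot x=f(x,u,d)$, $y=h(x)$ with the sampled controller $u(t)=\kappa(y(t_k))$, $t\in[t_k,t_{k+1})$, $k\in\mathbb{N}$, where $d$ may include a non-vanishing external disturbance, and suppose its impulsive form satisfies Assumption B (see context). Let $\alpha_q,V_q,\sigma_q$ be as described in the context, and let $\hat\alpha_\varpi,\gamma\in\mathcal{K}_\infty$ satisfy $\hat\alpha_\varpi(s)>\sigma_q(s)/2$ and $\gamma(s)>\hat\alpha_\varpi(s)+\alpha_\varpi(s)$ for $s>0$. Suppose $\varpi(t_0)=0$, and $\sigma_\varpi(s)=\mathcal{O}(\alpha(s))$, $\gamma(s)=\mathcal{O}(\underline{\alpha}_\varpi(s))$ as $s\to0^+$. Let $\bar d$ be a bound of the disturbance, $\|d(t)\|\le\bar d$ for $t\ge t_0$. If the sampling instants are generated by $$t_{k+1}=\inf_{t\ge t_k}\Big\{\,2(t-t_k)\,\gamma(\|\varpi_{[t_k,t]}\|)\ \ge\ \max_{\tau\in[t_k,t]}U(\varpi(\tau)),\ \text{ and }\ \|\varpi_{[t_k,t]}\|\neq0\Big\},$$ then the trajectories of the closed-loop system are ultimately bounded: there exist functions $\underline{\alpha}_\upsilon,\bar\alpha_\upsilon,\alpha_\upsilon,\varsigma_\upsilon\in\mathcal{K}_\infty$ such that, for each initial condition $x_0=x(t_0)$, there is $\Delta t(x_0)$, possibly depending on $x_0$, with $$\|x(t)\|\le\underline{\alpha}_\upsilon^{-1}\circ\bar\alpha_\upsilon\circ\alpha_\upsilon^{-1}\circ\varsigma_\upsilon(\bar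 d),\qquad\forall t\ge t_0+\Delta t(x_0),$$ and Zeno behavior is avoided.
   Context: System: $x\in\mathbb{R}^n$ is the state, $y\in\mathbb{R}^q$ the output, $u\in\mathbb{R}^m$ the input, and $d=d(t)\in\mathbb{R}^{n_d}$ takes values in a compact set $\mathbb{D}$. The function $f$ is continuously differentiable; $h(0)=0$; $\kappa$ is continuously differentiable with $\kappa(0)=0$, and $\kappa\circ h$ is differentiable. Sampling error: $\varpi(t)=\kappa\circ h(x(t_k))-\kappa\circ h(x(t))$ for $t\in[t_k,t_{k+1})$. The closed-loop system has the impulsive form $\dot x=f_c(x,\varpi,d):=f(x,\kappa\circ h(x)+\varpi,d)$, $\dot\varpi=\psi(x,\varpi,d):=-\frac{\partial(\kappa\circ h)(x)}{\partial x}f_c(x,\varpi,d)$ for $t\in[t_k,t_{k+1})$, and $\varpi(t_k^+)=0$. On an interval $[t_k,t]$ in the sampling law, $\varpi$ denotes the error relative to the sample at $t_k$ (so it starts from $0$ at $t_k$ and evolves continuously), and the infimum is over those $t$ for which the condition in braces holds ($+\infty$ if none). Notation: $\mathbb{N}$ is the set of non-negative integers; $\|x_{[a,b]}\|=\sup_{t\in[a,b]}\|x(t)\|$. For $\mathcal{K}_\infty$ functions, $\alpha'(s)=\mathcal{O}(\alpha(s))$ as $s\to0^+$ means $\limsup_{s\to0^+}\alpha'(s)/\alpha(s)<\infty$. For a continuously differentiable $V:\mathbb{R}^n\to\mathbb{R}_{\ge0}$, $V(x)\sim\{\underline{\alpha},\bar\alpha,\alpha,(\sigma,\varsigma)\mid\dot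 x=f_c(x,\varpi,d)\}$ means $\underline{\alpha},\bar\alpha,\alpha,\sigma,\varsigma\in\mathcal{K}_\infty$, $\underline{\alpha}(\|x\|)\le V(x)\le\bar\alpha(\|x\|)$ and, along $\dot x=f_c(x,\varpi,d)$, $\dot V(x)\le-\alpha(\|x\|)+\sigma(\|\varpi\|)+\varsigma(\|d\|)$ for all $x\in\mathbb{R}^n,\varpi\in\mathbb{R}^m,d\in\mathbb{D}$. Assumption B: The $x$-subsystem has an ISS-Lyapunov function $V(x)\sim\{\underline{\alpha},\bar\alpha,\alpha,(\sigma,\varsigma)\mid\dot x=f_c(x,\varpi,d)\}$. There exists a continuously differentiable $U:\mathbb{R}^m\to\mathbb{R}_{\ge0}$ such that, for all $x\in\mathbb{R}^n,\varpi\in\mathbb{R}^m,d\in\mathbb{D}$, $\underline{\alpha}_\varpi(\|\varpi\|)\le U(\varpi)\le\bar\alpha_\varpi(\|\varpi\|)$ and $\dot U(\varpi)=\big(\frac{\partial U(\varpi)}{\partial\varpi}\big)^{T}\psi(x,\varpi,d)\le\alpha_\varpi(\|\varpi\|)+\sigma_\varpi(\|x\|)+\varsigma_\varpi(\|d\|)$ for some $\underline{\alpha}_\varpi,\bar\alpha_\varpi,\alpha_\varpi,\sigma_\varpi,\varsigma_\varpi\in\mathcal{K}_\infty$. Functions used: $\alpha_q\in\mathcal{K}_\infty$ satisfies $\alpha_q(s)>2\sigma_\varpi(s)$ for $s>0$ and $\alpha_q(s)=\mathcal{O}(\alpha(s))$ as $s\to0^+$; $V_q(x)\sim\{\underline{\alpha}_q,\bar\alpha_q,\alpha_q,(\sigma_q,\varsigma_q)\mid\dot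 x=f_c(x,\varpi,d)\}$ is an associated ISS-Lyapunov function with $\underline{\alpha}_q,\bar\alpha_q,\sigma_q,\varsigma_q\in\mathcal{K}_\infty$ (it exists by the changing-supply-function technique applied to $V$). Zeno behavior is avoided means that only a finite number of events are triggered in any finite amount of time.
   Formalization: The bound of the disturbance is required to be positive: for bound 0 the stated estimate would force the state to reach 0 in finite time, which fails for x' = -x + d with d = 0; zero disturbance stays covered with any positive bound. *)

theory Defs
  imports "HOL-Analysis.Analysis" "HOL-Library.Landau_Symbols"
begin

text \<open>Only the values on \<open>[0, \<infinity>)\<close> of a comparison function matter; accordingly its inverse is
  \<open>inv_into {0..}\<close>.\<close>

definition class_K_inf :: "(real \<Rightarrow> real) \<Rightarrow> bool" where
  "class_K_inf \<alpha> \<longleftrightarrow>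
     continuous_on {0..} \<alpha> \<and> strict_mono_on {0..} \<alpha> \<and> \<alpha> 0 = 0 \<and> filterlim \<alpha> at_top at_top"

definition cont_diff :: "('a::real_normed_vector \<Rightarrow> 'b::real_normed_vector) \<Rightarrow> bool" where
  "cont_diff F \<longleftrightarrow>
     (\<exists>F' :: 'a \<Rightarrow> 'a \<Rightarrow>\<^sub>L 'b.
        (\<forall>x. (F has_derivative blinfun_apply (F' x)) (at x)) \<and> continuous_on UNIV F')"

text \<open>Right-hand sides of the impulsive form; \<open>g\<close> stands for the output feedback \<open>\<kappa> \<circ> h\<close> and \<open>w\<close> for
  the sampling error.\<close>

definition closed_loop_field ::
  "((real^'n) \<times> (real^'m) \<times> (real^'d) \<Rightarrow> real^'n) \<Rightarrow> (real^'n \<Rightarrow> real^'m)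
    \<Rightarrow> real^'n \<Rightarrow> real^'m \<Rightarrow> real^'d \<Rightarrow> real^'n" where
  "closed_loop_field f g x w d = f (x, g x + w, d)"

definition error_field ::
  "((real^'n) \<times> (real^'m) \<times> (real^'d) \<Rightarrow> real^'n) \<Rightarrow> (real^'n \<Rightarrow> real^'m)
    \<Rightarrow> real^'n \<Rightarrow> real^'m \<Rightarrow> real^'d \<Rightarrow> real^'m" where
  "error_field f g x w d = - frechet_derivative g (at x) (closed_loop_field f g x w d)"

text \<open>\<open>V(x) \<sim> {\<alpha>l, \<alpha>u, \<alpha>, (\<sigma>, \<zeta>) | x' = F(x, w, d)}\<close>, with \<open>d\<close> ranging over \<open>D\<close>.\<close>

definition ISS_Lyapunov ::
  "(real^'n \<Rightarrow> real^'m \<Rightarrow> real^'d \<Rightarrow> real^'n) \<Rightarrow> (real^'d) set \<Rightarrow> (real^'n \<Rightarrow> real)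
    \<Rightarrow> (real \<Rightarrow> real) \<Rightarrow> (real \<Rightarrow> real) \<Rightarrow> (real \<Rightarrow> real) \<Rightarrow> (real \<Rightarrow> real) \<Rightarrow> (real \<Rightarrow> real) \<Rightarrow> bool" where
  "ISS_Lyapunov F D V \<alpha>l \<alpha>u \<alpha> \<sigma> \<zeta> \<longleftrightarrow>
     class_K_inf \<alpha>l \<and> class_K_inf \<alpha>u \<and> class_K_inf \<alpha> \<and> class_K_inf \<sigma> \<and> class_K_inf \<zeta> \<and>
     cont_diff V \<and> (\<forall>x. 0 \<le> V x) \<and>
     (\<forall>x. \<alpha>l (norm x) \<le> V x \<and> V x \<le> \<alpha>u (norm x)) \<and>
     (\<forall>x w. \<forall>d\<in>D. frechet_derivative V (at x) (F x w d)
                     \<le> - \<alpha> (norm x) + \<sigma> (norm w) + \<zeta> (norm d))"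

definition error_growth_bound ::
  "(real^'n \<Rightarrow> real^'m \<Rightarrow> real^'d \<Rightarrow> real^'m) \<Rightarrow> (real^'d) set \<Rightarrow> (real^'m \<Rightarrow> real)
    \<Rightarrow> (real \<Rightarrow> real) \<Rightarrow> (real \<Rightarrow> real) \<Rightarrow> (real \<Rightarrow> real) \<Rightarrow> (real \<Rightarrow> real) \<Rightarrow> (real \<Rightarrow> real) \<Rightarrow> bool" where
  "error_growth_bound \<psi> D U \<alpha>l \<alpha>u \<alpha> \<sigma> \<zeta> \<longleftrightarrow>
     class_K_inf \<alpha>l \<and> class_K_inf \<alpha>u \<and> class_K_inf \<alpha> \<and> class_K_inf \<sigma> \<and> class_K_inf \<zeta> \<and>
     cont_diff U \<and> (\<forall>w. 0 \<le> U w) \<and>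
     (\<forall>w. \<alpha>l (norm w) \<le> U w \<and> U w \<le> \<alpha>u (norm w)) \<and>
     (\<forall>x w. \<forall>d\<in>D. frechet_derivative U (at w) (\<psi> x w d)
                     \<le> \<alpha> (norm w) + \<sigma> (norm x) + \<zeta> (norm d))"

text \<open>The error relative to the sample taken at time \<open>s\<close>; it vanishes at \<open>t = s\<close> and is not reset
  afterwards.\<close>

definition sampling_error ::
  "(real^'n \<Rightarrow> real^'m) \<Rightarrow> (real \<Rightarrow> real^'n) \<Rightarrow> real \<Rightarrow> real \<Rightarrow> real^'m" where
  "sampling_error g x s t = g (x s) - g (x t)"

definition sup_norm_on :: "(real \<Rightarrow> real^'m) \<Rightarrow> real \<Rightarrow> real \<Rightarrow> real" where
  "sup_norm_on w a b = (SUP \<tau>\<in>{a..b}. norm (w \<tau>))"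

text \<open>The supremum of \<open>U (w \<tau>)\<close> is a maximum whenever \<open>w\<close> and \<open>U\<close> are continuous.\<close>

definition event_condition ::
  "(real \<Rightarrow> real) \<Rightarrow> (real^'m \<Rightarrow> real) \<Rightarrow> (real \<Rightarrow> real^'m) \<Rightarrow> real \<Rightarrow> real \<Rightarrow> bool" where
  "event_condition \<gamma> U w s t \<longleftrightarrow>
     2 * (t - s) * \<gamma> (sup_norm_on w s t) \<ge> (SUP \<tau>\<in>{s..t}. U (w \<tau>)) \<and> sup_norm_on w s t \<noteq> 0"

text \<open>Sampling instants produced by a curve \<open>x\<close> on \<open>[t0, T)\<close>. The value \<open>\<infinity>\<close> means that there is no
  further event before \<open>T\<close>: the infimum of the empty set is \<open>\<infinity>\<close>, and once this value is reached
  all later instants are \<open>\<infinity>\<close> as well.\<close>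

primrec sampling_instant ::
  "(real^'n \<Rightarrow> real^'m) \<Rightarrow> (real \<Rightarrow> real) \<Rightarrow> (real^'m \<Rightarrow> real) \<Rightarrow> real \<Rightarrow> ereal
    \<Rightarrow> (real \<Rightarrow> real^'n) \<Rightarrow> nat \<Rightarrow> ereal" where
  "sampling_instant g \<gamma> U t0 T x 0 = ereal t0"
| "sampling_instant g \<gamma> U t0 T x (Suc k) =
     (let s = sampling_instant g \<gamma> U t0 T x k in
      INF t\<in>{t. s \<le> ereal t \<and> ereal t < T \<and>
                event_condition \<gamma> U (sampling_error g x (real_of_ereal s)) (real_of_ereal s) t}.
        ereal t)"

text \<open>A trajectory on \<open>[t0, T)\<close> with the input held between sampling instants. Solutions are taken in
  the sense of Caratheodory, i.e. in integrated form, so that \<open>d\<close> need only be measurable. The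
  condition \<open>T \<le> (SUP k. t k)\<close> says that every time before \<open>T\<close> belongs to some sampling interval:
  in particular, a trajectory is not continued beyond an accumulation point of events.\<close>

definition closed_loop_trajectory ::
  "((real^'n) \<times> (real^'m) \<times> (real^'d) \<Rightarrow> real^'n) \<Rightarrow> (real^'n \<Rightarrow> real^'m) \<Rightarrow> (real \<Rightarrow> real)
    \<Rightarrow> (real^'m \<Rightarrow> real) \<Rightarrow> (real \<Rightarrow> real^'d) \<Rightarrow> real \<Rightarrow> ereal \<Rightarrow> (real \<Rightarrow> real^'n) \<Rightarrow> bool" where
  "closed_loop_trajectory f g \<gamma> U d t0 T x \<longleftrightarrow>
     ereal t0 < T \<and>
     T \<le> (SUP k. sampling_instant g \<gamma> U t0 T x k) \<and>
     (\<forall>k a b. sampling_instant g \<gamma> U t0 T x k \<le> ereal a \<and> a \<le> b \<and>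
        ereal b \<le> sampling_instant g \<gamma> U t0 T x (Suc k) \<and> ereal b < T \<longrightarrow>
        ((\<lambda>\<tau>. f (x \<tau>, g (x (real_of_ereal (sampling_instant g \<gamma> U t0 T x k))), d \<tau>))
          has_integral (x b - x a)) {a..b})"

definition maximal_trajectory ::
  "((real^'n) \<times> (real^'m) \<times> (real^'d) \<Rightarrow> real^'n) \<Rightarrow> (real^'n \<Rightarrow> real^'m) \<Rightarrow> (real \<Rightarrow> real)
    \<Rightarrow> (real^'m \<Rightarrow> real) \<Rightarrow> (real \<Rightarrow> real^'d) \<Rightarrow> real \<Rightarrow> ereal \<Rightarrow> (real \<Rightarrow> real^'n) \<Rightarrow> bool" where
  "maximal_trajectory f g \<gamma> U d t0 T x \<longleftrightarrow>
     closed_loop_trajectory f g \<gamma> U d t0 T x \<and>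
     (\<forall>T' x'. closed_loop_trajectory f g \<gamma> U d t0 T' x' \<and> T \<le> T' \<and>
        (\<forall>t. t0 \<le> t \<and> ereal t < T \<longrightarrow> x' t = x t) \<longrightarrow> T' = T)"

definition zeno_free :: "(nat \<Rightarrow> ereal) \<Rightarrow> bool" where
  "zeno_free s \<longleftrightarrow> (\<forall>t::real. finite {k. s k \<le> ereal t})"

end

theory Submission
  imports Defs
begin

text \<open>Let \<open>s\<close> be a sampling instant, \<open>t > s\<close> a time before the next one, \<open>M\<close> the supremum of the
  error norm on \<open>[s, t]\<close>, and \<open>A\<close> the integral of \<open>\<alpha>_q (norm x) / 2\<close> over \<open>[s, t]\<close>. The growth
  bound on \<open>U\<close> and the failure of the event condition give
  \<open>(t - s) * \<sigma>_q M \<le> A + (t - s) * \<zeta>_w dbar\<close>. With \<open>c = \<zeta>_q dbar + \<zeta>_w dbar\<close>, the Lyapunov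
  inequality then yields \<open>Vq (x t) \<le> Vq (x s) - A + c * (t - s)\<close>. If \<open>A \<ge> 3 * c * (t - s)\<close>, then
  \<open>Vq\<close> has decreased at rate \<open>c\<close>. Otherwise \<open>\<sigma>_q M \<le> 4 * c\<close>, so that \<open>Vq\<close> decreases along all of
  \<open>[s, t]\<close> wherever \<open>\<alpha>_q (norm x) \<ge> 10 * c\<close>. In both cases
  \<open>Vq (x t) \<le> max vstar (Vq (x s) - c * (t - s))\<close> with \<open>vstar = \<alpha>u_q (\<alpha>_q\<^sup>-\<^sup>1 (10 * c))\<close>, and this
  propagates through the sampling instants.

  On bounded sets \<open>\<gamma> \<le> C * \<alpha>l_w\<close>, so an event requires \<open>t - s \<ge> 1 / (2 * C)\<close>; this excludes Zeno
  behaviour, and with the a priori bound every trajectory on a bounded interval can be prolonged.\<close>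

subsection \<open>Comparison functions\<close>

text \<open>The obstacle is that the event condition compares suprema over \<open>[s, t]\<close>.
  Its failure therefore bounds the error supply only on average, through the dissipation accumulated
  on the whole interval, and gives no pointwise differential inequality for a combination of
  \<open>V\<close> and \<open>U\<close>. The estimate is thus made afresh for every \<open>t\<close>
  after a sample, and the dichotomy on \<open>A\<close> turns it into decay. The constants arise as
  follows. Since \<open>\<alpha>_q > 2 * \<sigma>_w\<close>, half of \<open>\<alpha>_q\<close>
  covers the growth of the error and the other half, \<open>A\<close>, is left for \<open>V\<close>.
  When \<open>A\<close> is below \<open>3 * c * (t - s)\<close>, division of the average bound by
  \<open>t - s\<close> bounds \<open>\<sigma>_q M\<close> by \<open>3 * c + c\<close>. As
  \<open>M\<close> is a supremum, this small-input bound holds at every time of the interval. With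
  the disturbance the supply is at most \<open>5 * c\<close>, and \<open>10 * c\<close> is twice
  that. Decay speaks of trajectories that exist, while existence for all time needs bounds. Hence
  the bounds are proved for trajectories on \<open>[t0, T)\<close> with \<open>T\<close> possibly
  finite, and \<open>T = \<infinity>\<close> is deduced afterwards.\<close>

lemma class_K_inf_0: "class_K_inf \<alpha> \<Longrightarrow> \<alpha> 0 = 0"
  by (simp add: class_K_inf_def)

lemma class_K_inf_less: "class_K_inf \<alpha> \<Longrightarrow> 0 \<le> a \<Longrightarrow> a < b \<Longrightarrow> \<alpha> a < \<alpha> b"
  unfolding class_K_inf_def strict_mono_on_def by auto

lemma class_K_inf_mono: "class_K_inf \<alpha> \<Longrightarrow> 0 \<le> a \<Longrightarrow> a \<le> b \<Longrightarrow> \<alpha> a \<le> \<alpha> b"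
  using class_K_inf_less[of \<alpha> a b] by (cases "a = b") auto

lemma class_K_inf_nonneg: "class_K_inf \<alpha> \<Longrightarrow> 0 \<le> a \<Longrightarrow> 0 \<le> \<alpha> a"
  using class_K_inf_mono[of \<alpha> 0 a] class_K_inf_0[of \<alpha>] by simp

lemma class_K_inf_pos: "class_K_inf \<alpha> \<Longrightarrow> 0 < a \<Longrightarrow> 0 < \<alpha> a"
  using class_K_inf_less[of \<alpha> 0 a] class_K_inf_0[of \<alpha>] by simp

lemma class_K_inf_continuous_on: "class_K_inf \<alpha> \<Longrightarrow> S \<subseteq> {0..} \<Longrightarrow> continuous_on S \<alpha>"
  unfolding class_K_inf_def using continuous_on_subset by blast

lemma class_K_inf_continuous_on_norm:
  assumes "class_K_inf \<alpha>" "continuous_on S w"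
  shows "continuous_on S (\<lambda>t. \<alpha> (norm (w t)))"
  by (rule continuous_on_compose2[OF class_K_inf_continuous_on[OF assms(1) order_refl]
        continuous_on_norm[OF assms(2)]]) auto

lemma class_K_inf_add_scale:
  assumes "class_K_inf \<alpha>" "class_K_inf \<beta>" "0 < k"
  shows "class_K_inf (\<lambda>s. k * (\<alpha> s + \<beta> s))"
  unfolding class_K_inf_def
proof (intro conjI)
  show "continuous_on {0..} (\<lambda>s. k * (\<alpha> s + \<beta> s))"
    using assms by (intro continuous_intros class_K_inf_continuous_on) auto
  show "strict_mono_on {0..} (\<lambda>s. k * (\<alpha> s + \<beta> s))"
  proof (rule strict_mono_onI)
    fix r s :: real assume "r \<in> {0..}" "s \<in> {0..}" "r < s"
    then have "\<alpha> r + \<beta> r < \<alpha> s + \<beta> s"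
      by (intro add_strict_mono class_K_inf_less[OF assms(1)] class_K_inf_less[OF assms(2)]) auto
    then show "k * (\<alpha> r + \<beta> r) < k * (\<alpha> s + \<beta> s)" using assms(3) by simp
  qed
  show "k * (\<alpha> 0 + \<beta> 0) = 0" using assms by (simp add: class_K_inf_0)
  have "filterlim \<alpha> at_top at_top" "filterlim \<beta> at_top at_top"
    using assms by (auto simp: class_K_inf_def)
  then show "filterlim (\<lambda>s. k * (\<alpha> s + \<beta> s)) at_top at_top"
    by (intro filterlim_tendsto_pos_mult_at_top[OF tendsto_const assms(3)]
        filterlim_at_top_add_at_top)
qed

lemma class_K_inf_surj:
  assumes "class_K_inf \<alpha>" "0 \<le> y"
  shows "\<exists>x\<ge>0. \<alpha> x = y"
proof -
  have "eventually (\<lambda>x. y \<le> \<alpha> x) at_top"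
    using assms by (simp add: class_K_inf_def filterlim_at_top)
  then obtain b where b: "\<And>x. x \<ge> b \<Longrightarrow> y \<le> \<alpha> x" by (auto simp: eventually_at_top_linorder)
  have "\<exists>x. 0 \<le> x \<and> x \<le> max 0 b \<and> \<alpha> x = y"
    by (rule IVT') (use assms b class_K_inf_0[OF assms(1)] in \<open>auto intro: class_K_inf_continuous_on\<close>)
  then show ?thesis by blast
qed

lemma class_K_inf_inv:
  assumes "class_K_inf \<alpha>" "0 \<le> y"
  shows "0 \<le> inv_into {0..} \<alpha> y" "\<alpha> (inv_into {0..} \<alpha> y) = y"
proof -
  have "y \<in> \<alpha> ` {0..}" using class_K_inf_surj[OF assms] by auto
  then show "0 \<le> inv_into {0..} \<alpha> y" "\<alpha> (inv_into {0..} \<alpha> y) = y"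
    using inv_into_into[of y \<alpha> "{0..}"] f_inv_into_f[of y \<alpha> "{0..}"] by auto
qed

lemma class_K_inf_le_inv:
  assumes "class_K_inf \<alpha>" "0 \<le> x" "\<alpha> x \<le> y"
  shows "x \<le> inv_into {0..} \<alpha> y"
proof -
  have y: "0 \<le> y" using class_K_inf_nonneg[OF assms(1,2)] assms(3) by simp
  show ?thesis
    using class_K_inf_less[OF assms(1) class_K_inf_inv(1)[OF assms(1) y], of x]
      class_K_inf_inv(2)[OF assms(1) y] assms(3) by fastforce
qed

subsection \<open>Caratheodory solutions\<close>

text \<open>The integral equation is required on every subinterval, not only on those starting at
  \<open>a\<close>. Restriction is then immediate, and the shape matches the integral clause of
  \<open>closed_loop_trajectory\<close>.\<close>

definition caratheodory_solution ::
  "(real \<Rightarrow> 'a \<Rightarrow> 'a) \<Rightarrow> (real \<Rightarrow> 'a::euclidean_space) \<Rightarrow> real \<Rightarrow> real \<Rightarrow> bool" where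
  "caratheodory_solution F x a b \<longleftrightarrow>
     (\<forall>r1 r2. a \<le> r1 \<and> r1 \<le> r2 \<and> r2 \<le> b \<longrightarrow>
        ((\<lambda>\<tau>. F \<tau> (x \<tau>)) has_integral (x r2 - x r1)) {r1..r2})"

lemma caratheodory_solutionD:
  "caratheodory_solution F x a b \<Longrightarrow> a \<le> r1 \<Longrightarrow> r1 \<le> r2 \<Longrightarrow> r2 \<le> b \<Longrightarrow>
     ((\<lambda>\<tau>. F \<tau> (x \<tau>)) has_integral (x r2 - x r1)) {r1..r2}"
  by (simp add: caratheodory_solution_def)

lemma caratheodory_solution_subinterval:
  "caratheodory_solution F x a b \<Longrightarrow> a \<le> a' \<Longrightarrow> b' \<le> b \<Longrightarrow> caratheodory_solution F x a' b'"
  by (auto simp: caratheodory_solution_def)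

lemma caratheodory_solution_cong:
  assumes "caratheodory_solution F x a b" "\<And>t. a \<le> t \<Longrightarrow> t \<le> b \<Longrightarrow> x' t = x t"
  shows "caratheodory_solution F x' a b"
  unfolding caratheodory_solution_def
proof (intro allI impI)
  fix r1 r2 assume r: "a \<le> r1 \<and> r1 \<le> r2 \<and> r2 \<le> b"
  have "((\<lambda>\<tau>. F \<tau> (x \<tau>)) has_integral (x r2 - x r1)) {r1..r2}"
    using r by (intro caratheodory_solutionD[OF assms(1)]) auto
  then have "((\<lambda>\<tau>. F \<tau> (x' \<tau>)) has_integral (x r2 - x r1)) {r1..r2}"
    by (rule has_integral_eq[rotated]) (use r assms(2) in auto)
  moreover have "x' r1 = x r1" "x' r2 = x r2" using assms(2) r by auto
  ultimately show "((\<lambda>\<tau>. F \<tau> (x' \<tau>)) has_integral (x' r2 - x' r1)) {r1..r2}" by simp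
qed

lemma caratheodory_solution_continuous_on:
  assumes "caratheodory_solution F x a b"
  shows "continuous_on {a..b} x"
proof (cases "a \<le> b")
  case True
  have eq: "x t = x a + integral {a..t} (\<lambda>\<tau>. F \<tau> (x \<tau>))" if "t \<in> {a..b}" for t
    using integral_unique[OF caratheodory_solutionD[OF assms order_refl, of t]] that by simp
  have "(\<lambda>\<tau>. F \<tau> (x \<tau>)) integrable_on {a..b}"
    by (rule has_integral_integrable[OF caratheodory_solutionD[OF assms order_refl True order_refl]])
  then have "continuous_on {a..b} (\<lambda>t. x a + integral {a..t} (\<lambda>\<tau>. F \<tau> (x \<tau>)))"
    by (intro continuous_intros indefinite_integral_continuous_1)
  then show ?thesis by (rule continuous_on_eq) (rule eq[symmetric])
qed simp

lemma caratheodory_solution_combine: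
  assumes 1: "caratheodory_solution F x a b" and 2: "caratheodory_solution F x b c"
  shows "caratheodory_solution F x a c"
  unfolding caratheodory_solution_def
proof (intro allI impI)
  fix r1 r2 assume r: "a \<le> r1 \<and> r1 \<le> r2 \<and> r2 \<le> c"
  consider "r2 \<le> b" | "b \<le> r1" | "r1 \<le> b" "b \<le> r2" by linarith
  then show "((\<lambda>\<tau>. F \<tau> (x \<tau>)) has_integral (x r2 - x r1)) {r1..r2}"
  proof cases
    case 3
    have "((\<lambda>\<tau>. F \<tau> (x \<tau>)) has_integral (x b - x r1) + (x r2 - x b)) {r1..r2}"
      by (rule has_integral_combine[of _ b])
        (use 3 r caratheodory_solutionD[OF 1] caratheodory_solutionD[OF 2] in auto)
    then show ?thesis by simp
  qed (use r caratheodory_solutionD[OF 1] caratheodory_solutionD[OF 2] in auto)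
qed

text \<open>The last time at which \<open>\<psi> t \<le> \<psi> a + \<epsilon> * (t - a)\<close>
  exists by closedness, and right growth would carry the inequality beyond it unless it is
  \<open>b\<close>. Then \<open>\<epsilon>\<close> tends to 0.\<close>

lemma nonincreasing_of_right_growth:
  fixes \<psi> :: "real \<Rightarrow> real"
  assumes cont: "continuous_on {a..b} \<psi>" and ab: "a \<le> b"
    and growth: "\<And>t \<epsilon>. a \<le> t \<Longrightarrow> t < b \<Longrightarrow> 0 < \<epsilon> \<Longrightarrow>
        \<exists>\<delta>>0. \<forall>h. 0 < h \<and> h < \<delta> \<and> t + h \<le> b \<longrightarrow> \<psi> (t + h) \<le> \<psi> t + \<epsilon> * h"
  shows "\<psi> b \<le> \<psi> a"
proof -
  have main: "\<psi> b \<le> \<psi> a + \<epsilon> * (b - a)" if \<epsilon>: "0 < \<epsilon>" for \<epsilon>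
  proof (rule ccontr)
    assume not: "\<not> ?thesis"
    define S where "S = {a..b} \<inter> (\<lambda>t. \<psi> t - \<epsilon> * (t - a)) -` {..\<psi> a}"
    have "closed S" unfolding S_def
      by (intro continuous_closed_preimage continuous_intros cont)
    moreover have aS: "a \<in> S" using ab by (simp add: S_def)
    moreover have bdd: "bdd_above S" unfolding S_def by (rule bdd_aboveI[of _ b]) auto
    ultimately have m: "Sup S \<in> S" by (intro closed_contains_Sup) auto
    let ?m = "Sup S"
    have mb: "a \<le> ?m" "?m < b" using m not by (auto simp: S_def less_le)
    from growth[OF mb \<epsilon>] obtain \<delta> where \<delta>: "\<delta> > 0"
      "\<And>h. 0 < h \<Longrightarrow> h < \<delta> \<Longrightarrow> ?m + h \<le> b \<Longrightarrow> \<psi> (?m + h) \<le> \<psi> ?m + \<epsilon> * h" by blast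
    define h where "h = min (\<delta>/2) (b - ?m)"
    have h: "0 < h" "h < \<delta>" "?m + h \<le> b" using \<delta>(1) mb by (auto simp: h_def min_def)
    have "?m + h \<in> S" using \<delta>(2)[OF h] m mb h by (auto simp: S_def algebra_simps)
    then have "?m + h \<le> ?m" using bdd cSup_upper by blast
    with h show False by simp
  qed
  show ?thesis
  proof (cases "a = b")
    case False
    show ?thesis
    proof (rule field_le_epsilon)
      fix e :: real assume "0 < e"
      then show "\<psi> b \<le> \<psi> a + e" using main[of "e / (b - a)"] ab False by auto
    qed
  qed simp
qed

text \<open>The disturbance is only measurable, so \<open>\<Phi> \<circ> x\<close> need not be differentiable; its right
  difference quotients are nevertheless bounded uniformly over the values of the disturbance.\<close>

lemma right_growth_along_solution:
  fixes f :: "'a::euclidean_space \<times> 'b::euclidean_space \<times> 'c::euclidean_space \<Rightarrow> 'a"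
    and \<Phi> :: "'a \<Rightarrow> real"
  assumes sol: "caratheodory_solution (\<lambda>\<tau> y. f (y, u, d \<tau>)) x a b"
    and f: "continuous_on UNIV f" and D: "compact D"
    and d: "\<And>t. a \<le> t \<Longrightarrow> t \<le> b \<Longrightarrow> d t \<in> D"
    and t: "a \<le> t" "t < b"
    and \<Phi>: "(\<Phi> has_derivative \<Phi>') (at (x t))"
    and P: "\<And>v. v \<in> D \<Longrightarrow> \<Phi>' (f (x t, u, v)) \<le> P"
    and \<epsilon>: "0 < \<epsilon>"
  shows "\<exists>\<delta>>0. \<forall>h. 0 < h \<and> h < \<delta> \<and> t + h \<le> b \<longrightarrow> \<Phi> (x (t + h)) \<le> \<Phi> (x t) + (P + \<epsilon>) * h"
proof -
  have xc: "continuous_on {a..b} x" using sol by (rule caratheodory_solution_continuous_on)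
  have lin: "bounded_linear \<Phi>'" using \<Phi> has_derivative_bounded_linear by blast
  then obtain L where L: "L > 0" "\<And>v. \<bar>\<Phi>' v\<bar> \<le> norm v * L"
    using bounded_linear.pos_bounded[OF lin] by auto
  \<comment> \<open>\<open>K\<close> also contains the mixed points
    \<open>(x t, u, d \<tau>)\<close>: the state is frozen while the disturbance keeps its value, so
    one modulus of continuity serves all disturbance values.\<close>
  define K where "K = x ` {a..b} \<times> {u} \<times> D"
  have K: "compact K" unfolding K_def
    by (intro compact_Times compact_continuous_image xc D) auto
  have fK: "continuous_on K f" using f continuous_on_subset by blast
  obtain B where B: "B > 0" "\<And>z. z \<in> K \<Longrightarrow> norm (f z) \<le> B"
    using compact_imp_bounded[OF compact_continuous_image[OF fK K]]
    by (auto simp: bounded_pos)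
  \<comment> \<open>Half of \<open>\<epsilon>\<close> is spent on freezing the state inside
    \<open>f\<close>, costing \<open>\<eta> * L\<close>; the other half goes to the linearisation of
    \<open>\<Phi>\<close>, costing \<open>\<eta>' * B\<close> per unit of time.\<close>
  define \<eta> where "\<eta> = \<epsilon> / (2 * L)"
  have \<eta>: "\<eta> > 0" using L \<epsilon> by (simp add: \<eta>_def)
  obtain \<delta>1 where \<delta>1: "\<delta>1 > 0"
    "\<And>z z'. z \<in> K \<Longrightarrow> z' \<in> K \<Longrightarrow> dist z' z < \<delta>1 \<Longrightarrow> dist (f z') (f z) < \<eta>"
    using compact_uniformly_continuous[OF fK K] \<eta> unfolding uniformly_continuous_on_def by metis
  have "(x \<longlongrightarrow> x t) (at t within {a..b})" using xc t by (auto simp: continuous_on_def)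
  then obtain \<delta>2 where \<delta>2: "\<delta>2 > 0"
    "\<And>r. r \<in> {a..b} \<Longrightarrow> r \<noteq> t \<Longrightarrow> dist r t < \<delta>2 \<Longrightarrow> dist (x r) (x t) < \<delta>1"
    using \<delta>1(1) unfolding Lim_within by (metis zero_less_dist_iff)
  define \<eta>' where "\<eta>' = \<epsilon> / (2 * B)"
  have \<eta>': "\<eta>' > 0" using B \<epsilon> by (simp add: \<eta>'_def)
  obtain \<delta>3 where \<delta>3: "\<delta>3 > 0" "\<And>y. norm (y - x t) < \<delta>3 \<Longrightarrow>
      norm (\<Phi> y - \<Phi> (x t) - \<Phi>' (y - x t)) \<le> \<eta>' * norm (y - x t)"
    using \<Phi> \<eta>' unfolding has_derivative_at_alt by blast
  define \<delta> where "\<delta> = min \<delta>2 (\<delta>3 / B)"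
  have "\<delta> > 0" using \<delta>2 \<delta>3 B by (simp add: \<delta>_def)
  moreover have "\<Phi> (x (t + h)) \<le> \<Phi> (x t) + (P + \<epsilon>) * h"
    if h: "0 < h" "h < \<delta>" "t + h \<le> b" for h
  proof -
    let ?v = "x (t + h) - x t"
    have int: "((\<lambda>\<tau>. f (x \<tau>, u, d \<tau>)) has_integral ?v) {t..t+h}"
      using caratheodory_solutionD[OF sol, of t "t + h"] t h by simp
    have inK: "(x \<tau>, u, d \<tau>) \<in> K" "(x t, u, d \<tau>) \<in> K" if "\<tau> \<in> {t..t+h}" for \<tau>
      using that t h d by (auto simp: K_def)
    have nv: "norm ?v \<le> B * h"
      using has_integral_bound[of B "\<lambda>\<tau>. f (x \<tau>, u, d \<tau>)" ?v t "t + h"] int B inK h by auto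
    also have "B * h < \<delta>3" using h B by (simp add: \<delta>_def field_simps)
    finally have "norm (\<Phi> (x (t + h)) - \<Phi> (x t) - \<Phi>' ?v) \<le> \<eta>' * norm ?v" using \<delta>3 by blast
    also have "\<dots> \<le> \<eta>' * (B * h)" using nv \<eta>' by simp
    also have "\<dots> = \<epsilon> / 2 * h" using B by (simp add: \<eta>'_def)
    finally have 1: "\<Phi> (x (t + h)) - \<Phi> (x t) \<le> \<Phi>' ?v + \<epsilon> / 2 * h"
      unfolding real_norm_def by linarith
    have "((\<Phi>' \<circ> (\<lambda>\<tau>. f (x \<tau>, u, d \<tau>))) has_integral \<Phi>' ?v) {t..t+h}"
      using has_integral_linear[OF int lin] .
    moreover have "((\<lambda>\<tau>. P + \<epsilon> / 2) has_integral (P + \<epsilon> / 2) * h) {t..t+h}"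
      using has_integral_const_real[of "P + \<epsilon> / 2" t "t + h"] h by (simp add: mult.commute)
    moreover have "(\<Phi>' \<circ> (\<lambda>\<tau>. f (x \<tau>, u, d \<tau>))) \<tau> \<le> P + \<epsilon> / 2" if \<tau>: "\<tau> \<in> {t..t+h}" for \<tau>
    proof -
      have "dist (x \<tau>) (x t) < \<delta>1"
      proof (cases "\<tau> = t")
        case False
        then show ?thesis
          using \<delta>2(2)[of \<tau>] \<tau> t h by (auto simp: dist_real_def \<delta>_def)
      qed (use \<delta>1 in simp)
      then have "dist (x \<tau>, u, d \<tau>) (x t, u, d \<tau>) < \<delta>1" by (simp add: dist_Pair_Pair)
      then have "dist (f (x \<tau>, u, d \<tau>)) (f (x t, u, d \<tau>)) < \<eta>" using \<delta>1(2) inK \<tau> by blast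
      then have "norm (f (x \<tau>, u, d \<tau>) - f (x t, u, d \<tau>)) * L \<le> \<eta> * L"
        using L(1) by (simp add: dist_norm)
      then have "\<Phi>' (f (x \<tau>, u, d \<tau>) - f (x t, u, d \<tau>)) \<le> \<eta> * L"
        using L(2)[of "f (x \<tau>, u, d \<tau>) - f (x t, u, d \<tau>)"] by linarith
      moreover have "\<Phi>' (f (x t, u, d \<tau>)) \<le> P" using P d \<tau> t h by auto
      ultimately show ?thesis
        using L(1) by (simp add: \<eta>_def linear_diff[OF bounded_linear.linear[OF lin]])
    qed
    ultimately have "\<Phi>' ?v \<le> (P + \<epsilon> / 2) * h" by (rule has_integral_le)
    with 1 show ?thesis by (simp add: algebra_simps)
  qed
  ultimately show ?thesis by blast
qed

text \<open>Applied to \<open>V\<close> and to \<open>y \<mapsto> U (u - g y)\<close>. The latter is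
  only known to be differentiable at each point, as \<open>g\<close> is, so
  \<open>\<Phi> \<circ> x\<close> is compared with the primitive of \<open>P \<circ> x\<close>
  through right increments.\<close>

lemma growth_along_solution:
  fixes f :: "'a::euclidean_space \<times> 'b::euclidean_space \<times> 'c::euclidean_space \<Rightarrow> 'a"
    and \<Phi> :: "'a \<Rightarrow> real"
  assumes sol: "caratheodory_solution (\<lambda>\<tau> y. f (y, u, d \<tau>)) x a b"
    and f: "continuous_on UNIV f" and D: "compact D"
    and d: "\<And>t. a \<le> t \<Longrightarrow> t \<le> b \<Longrightarrow> d t \<in> D"
    and \<Phi>: "\<And>y. (\<Phi> has_derivative \<Phi>' y) (at y)"
    and P: "\<And>y v. v \<in> D \<Longrightarrow> \<Phi>' y (f (y, u, v)) \<le> P y"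
    and Pc: "continuous_on {a..b} (\<lambda>t. P (x t))"
    and ab: "a \<le> b"
  shows "\<Phi> (x b) \<le> \<Phi> (x a) + integral {a..b} (\<lambda>t. P (x t))"
proof -
  define I where "I t = integral {a..t} (\<lambda>t. P (x t))" for t
  have xc: "continuous_on {a..b} x" using sol by (rule caratheodory_solution_continuous_on)
  have \<Phi>c: "continuous_on UNIV \<Phi>" using \<Phi> has_derivative_continuous_on by blast
  have Pi: "(\<lambda>t. P (x t)) integrable_on {a..b}" using Pc integrable_continuous_real by blast
  have Ic: "continuous_on {a..b} I" unfolding I_def by (intro indefinite_integral_continuous_1 Pi)
  have "\<Phi> (x b) - I b \<le> \<Phi> (x a) - I a"
  proof (rule nonincreasing_of_right_growth[OF _ ab])
    show "continuous_on {a..b} (\<lambda>t. \<Phi> (x t) - I t)"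
      using continuous_on_compose2[OF \<Phi>c xc] Ic by (auto intro: continuous_intros)
    fix t \<epsilon> :: real assume t: "a \<le> t" "t < b" and \<epsilon>: "0 < \<epsilon>"
    obtain \<delta>1 where \<delta>1: "\<delta>1 > 0" "\<And>h. 0 < h \<Longrightarrow> h < \<delta>1 \<Longrightarrow> t + h \<le> b \<Longrightarrow>
        \<Phi> (x (t + h)) \<le> \<Phi> (x t) + (P (x t) + \<epsilon> / 2) * h"
      using right_growth_along_solution[OF sol f D d t \<Phi> P, of "\<epsilon> / 2"] \<epsilon> by auto
    have "(I has_real_derivative P (x t)) (at t within {a..b})"
      unfolding I_def by (rule integral_has_real_derivative) (use Pc t in auto)
    then have "(I has_derivative (\<lambda>h. h * P (x t))) (at t within {a..b})"
      by (simp add: has_field_derivative_def mult_commute_abs)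
    then obtain \<delta>2 where \<delta>2: "\<delta>2 > 0" "\<And>r. r \<in> {a..b} \<Longrightarrow> norm (r - t) < \<delta>2 \<Longrightarrow>
        norm (I r - I t - (r - t) * P (x t)) \<le> \<epsilon> / 2 * norm (r - t)"
      using \<epsilon> unfolding has_derivative_within_alt by (metis half_gt_zero)
    show "\<exists>\<delta>>0. \<forall>h. 0 < h \<and> h < \<delta> \<and> t + h \<le> b \<longrightarrow>
        \<Phi> (x (t + h)) - I (t + h) \<le> \<Phi> (x t) - I t + \<epsilon> * h"
    proof (intro exI[of _ "min \<delta>1 \<delta>2"] conjI allI impI)
      fix h assume h: "0 < h \<and> h < min \<delta>1 \<delta>2 \<and> t + h \<le> b"
      have "\<bar>I (t + h) - I t - h * P (x t)\<bar> \<le> \<epsilon> / 2 * h"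
        using \<delta>2(2)[of "t + h"] h t by auto
      then have "I (t + h) \<ge> I t + h * P (x t) - \<epsilon> / 2 * h" by linarith
      moreover have "\<Phi> (x (t + h)) \<le> \<Phi> (x t) + (P (x t) + \<epsilon> / 2) * h" using \<delta>1 h by auto
      ultimately show "\<Phi> (x (t + h)) - I (t + h) \<le> \<Phi> (x t) - I t + \<epsilon> * h"
        by (simp add: algebra_simps)
    qed (use \<delta>1 \<delta>2 in auto)
  qed
  then show ?thesis by (simp add: I_def)
qed

subsection \<open>Existence for a held input\<close>

text \<open>Continuity is asked on the half-open interval because, at the end of a trajectory, the
  value of the curve is known only after this integral exists. The end point is a null set.\<close>

lemma integrable_along_curve:
  fixes f :: "'a::euclidean_space \<times> 'b::euclidean_space \<times> 'c::euclidean_space \<Rightarrow> 'a"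
    and d :: "real \<Rightarrow> 'c"
  assumes f: "continuous_on UNIV f" and D: "compact D"
    and dm: "d \<in> borel_measurable (lebesgue_on {t0..})" and d: "\<And>t. t0 \<le> t \<Longrightarrow> d t \<in> D"
    and a: "t0 \<le> a" and x: "continuous_on {a..<b} x"
    and X: "\<And>t. a \<le> t \<Longrightarrow> t < b \<Longrightarrow> norm (x t) \<le> X"
  shows "(\<lambda>\<tau>. f (x \<tau>, u, d \<tau>)) integrable_on {a..b}"
proof -
  have K: "compact (cball (0::'a) X \<times> {u} \<times> D)" by (intro compact_Times D) auto
  obtain B where B: "\<And>z. z \<in> cball 0 X \<times> {u} \<times> D \<Longrightarrow> norm (f z) \<le> B"
    using compact_imp_bounded[OF compact_continuous_image[OF continuous_on_subset[OF f subset_UNIV] K]]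
    by (auto simp: bounded_iff)
  have S: "{a..<b} \<in> sets lebesgue" by simp
  have "x \<in> borel_measurable (lebesgue_on {a..<b})"
    using x S by (rule continuous_imp_measurable_on_sets_lebesgue)
  moreover have "d \<in> borel_measurable (lebesgue_on {a..<b})"
    by (rule measurable_restrict_mono[OF dm]) (use a in auto)
  ultimately have "(\<lambda>\<tau>. (x \<tau>, u, d \<tau>)) \<in> borel_measurable (lebesgue_on {a..<b})"
    by (intro borel_measurable_Pair) auto
  then have "(\<lambda>\<tau>. f (x \<tau>, u, d \<tau>)) \<in> borel_measurable (lebesgue_on {a..<b})"
    by (rule measurable_compose[OF _ borel_measurable_continuous_onI[OF f]])
  moreover have "{a..<b} \<in> lmeasurable"
    by (rule bounded_set_imp_lmeasurable) auto
  then have "(\<lambda>_. B) integrable_on {a..<b}" by (rule integrable_on_const)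
  moreover have "norm (f (x \<tau>, u, d \<tau>)) \<le> B" if "\<tau> \<in> {a..<b}" for \<tau>
    using that B[of "(x \<tau>, u, d \<tau>)"] X[of \<tau>] d[of \<tau>] a by simp
  ultimately have "(\<lambda>\<tau>. f (x \<tau>, u, d \<tau>)) integrable_on {a..<b}"
    using S by (rule measurable_bounded_by_integrable_imp_integrable)
  then show ?thesis
  proof (rule integrable_spike_set)
    show "negligible {\<tau> \<in> {a..<b} - {a..b}. f (x \<tau>, u, d \<tau>) \<noteq> 0}"
      by (rule negligible_subset[of "{b}"]) auto
    show "negligible {\<tau> \<in> {a..b} - {a..<b}. f (x \<tau>, u, d \<tau>) \<noteq> 0}"
      by (rule negligible_subset[of "{b}"]) auto
  qed
qed

lemma caratheodory_solution_integral:
  assumes int: "(\<lambda>\<tau>. F \<tau> (x \<tau>)) integrable_on {a..b}"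
    and x: "\<And>t. a \<le> t \<Longrightarrow> t \<le> b \<Longrightarrow> x t = x0 + integral {a..t} (\<lambda>\<tau>. F \<tau> (x \<tau>))"
  shows "caratheodory_solution F x a b"
  unfolding caratheodory_solution_def
proof (intro allI impI)
  fix r1 r2 assume r: "a \<le> r1 \<and> r1 \<le> r2 \<and> r2 \<le> b"
  have i2: "(\<lambda>\<tau>. F \<tau> (x \<tau>)) integrable_on {a..r2}"
    by (rule integrable_subinterval_real[OF int]) (use r in auto)
  have "integral {a..r1} (\<lambda>\<tau>. F \<tau> (x \<tau>)) + integral {r1..r2} (\<lambda>\<tau>. F \<tau> (x \<tau>))
      = integral {a..r2} (\<lambda>\<tau>. F \<tau> (x \<tau>))"
    by (rule Henstock_Kurzweil_Integration.integral_combine) (use r i2 in auto)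
  then have "x r2 - x r1 = integral {r1..r2} (\<lambda>\<tau>. F \<tau> (x \<tau>))"
    using x[of r1] x[of r2] r by (simp add: algebra_simps)
  moreover have "(\<lambda>\<tau>. F \<tau> (x \<tau>)) integrable_on {r1..r2}"
    by (rule integrable_subinterval_real[OF int]) (use r in auto)
  ultimately show "((\<lambda>\<tau>. F \<tau> (x \<tau>)) has_integral (x r2 - x r1)) {r1..r2}"
    by (simp add: has_integral_integrable_integral)
qed

lemma cont_diff_continuous_on: "cont_diff F \<Longrightarrow> continuous_on UNIV F"
  unfolding cont_diff_def
  by (meson continuous_at_imp_continuous_on has_derivative_continuous)

text \<open>Mean value inequality on the convex set \<open>C\<close>. The derivative is bounded on
  the compact \<open>C \<times> D\<close>, so the constant is uniform in the parameter and a merely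
  measurable \<open>d\<close> does not affect the contraction below.\<close>

lemma cont_diff_lipschitz_fst:
  fixes f :: "'a::euclidean_space \<times> 'b::euclidean_space \<Rightarrow> 'a"
  assumes f: "cont_diff f" and C: "compact C" "convex C" and D: "compact D"
  shows "\<exists>L>0. \<forall>y\<in>C. \<forall>z\<in>C. \<forall>v\<in>D. norm (f (y, v) - f (z, v)) \<le> L * norm (y - z)"
proof -
  obtain F' where F': "\<And>x. (f has_derivative blinfun_apply (F' x)) (at x)" "continuous_on UNIV F'"
    using f unfolding cont_diff_def by blast
  have "compact (C \<times> D)" using C D by (intro compact_Times)
  then obtain L where L: "L > 0" "\<And>z. z \<in> C \<times> D \<Longrightarrow> norm (F' z) \<le> L"
    using compact_imp_bounded[OF compact_continuous_image[OF continuous_on_subset[OF F'(2) subset_UNIV]]]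
    by (metis bounded_pos imageI)
  have "norm (f (y, v) - f (z, v)) \<le> L * norm (y - z)" if "y \<in> C" "z \<in> C" "v \<in> D" for y z v
  proof (rule differentiable_bound[OF C(2) _ _ that(1,2)])
    fix w assume w: "w \<in> C"
    have "((\<lambda>y. f (y, v)) has_derivative (\<lambda>h. blinfun_apply (F' (w, v)) (h, 0))) (at w)"
      by (rule has_derivative_compose[OF _ F'(1), of "\<lambda>y. (y, v)" "\<lambda>h. (h, 0)"])
        (auto intro!: derivative_eq_intros)
    then show "((\<lambda>y. f (y, v)) has_derivative (\<lambda>h. blinfun_apply (F' (w, v)) (h, 0))) (at w within C)"
      by (rule has_derivative_at_withinI)
    show "onorm (\<lambda>h. blinfun_apply (F' (w, v)) (h, 0)) \<le> L"
    proof (rule onorm_bound)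
      fix h
      have "norm (blinfun_apply (F' (w, v)) (h, 0)) \<le> norm (F' (w, v)) * norm (h, 0::'b)"
        by (rule norm_blinfun)
      also have "\<dots> \<le> L * norm h" using L(2)[of "(w, v)"] w that by (simp add: mult_right_mono)
      finally show "norm (blinfun_apply (F' (w, v)) (h, 0)) \<le> L * norm h" .
    qed (use L in simp)
  qed
  then show ?thesis using L by blast
qed

text \<open>Banach's fixed point theorem for the Picard operator, whose integrand is only measurable
  in time.\<close>

lemma local_existence:
  fixes f :: "'a::euclidean_space \<times> 'b::euclidean_space \<times> 'c::euclidean_space \<Rightarrow> 'a"
  assumes f: "cont_diff f" and D: "compact D"
    and dm: "d \<in> borel_measurable (lebesgue_on {t0..})" and d: "\<And>t. t0 \<le> t \<Longrightarrow> d t \<in> D"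
    and a: "t0 \<le> a"
  shows "\<exists>\<delta>>0. \<exists>y. y a = y0 \<and> caratheodory_solution (\<lambda>\<tau> y. f (y, u, d \<tau>)) y a (a + \<delta>)"
proof -
  define C where "C = cball y0 1"
  have fc: "continuous_on UNIV f" using f by (rule cont_diff_continuous_on)
  have "compact (C \<times> {u} \<times> D)" unfolding C_def by (intro compact_Times D) auto
  then obtain B where B: "B > 0" "\<And>z. z \<in> C \<times> {u} \<times> D \<Longrightarrow> norm (f z) \<le> B"
    using compact_imp_bounded[OF compact_continuous_image[OF continuous_on_subset[OF fc subset_UNIV]]]
    by (metis bounded_pos imageI)
  obtain L where L: "L > 0"
    "\<And>y z v. y \<in> C \<Longrightarrow> z \<in> C \<Longrightarrow> v \<in> {u} \<times> D \<Longrightarrow> norm (f (y, v) - f (z, v)) \<le> L * norm (y - z)"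
    using cont_diff_lipschitz_fst[OF f, of C "{u} \<times> D"] D by (auto simp: C_def compact_Times)
  \<comment> \<open>\<open>1 / B\<close> keeps the Picard iterates in the unit ball
    \<open>C\<close>; \<open>1 / (2 * L)\<close> makes the operator a contraction with factor
    1/2.\<close>
  define \<delta> where "\<delta> = min (1 / B) (1 / (2 * L))"
  have \<delta>: "\<delta> > 0" "\<delta> * B \<le> 1" "\<delta> * L \<le> 1 / 2"
    using B L by (auto simp: \<delta>_def min_def field_simps)
  \<comment> \<open>Clamping time to \<open>[a, a + \<delta>]\<close> turns the iterates into
    bounded continuous functions on the whole line, where the complete space of
    \<open>bcontfun\<close> is available.\<close>
  define c where "c t = max a (min t (a + \<delta>))" for t
  have c: "a \<le> c t" "c t \<le> a + \<delta>" for t using \<delta> by (auto simp: c_def)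
  have cc: "continuous_on UNIV c" unfolding c_def by (intro continuous_intros)
  define J where "J y t = integral {a..t} (\<lambda>\<tau>. f (y \<tau>, u, d \<tau>))" for y :: "real \<Rightarrow> 'a" and t
  define \<Phi> where "\<Phi> y t = y0 + J y (c t)" for y t
  define S :: "(real \<Rightarrow>\<^sub>C 'a) set" where "S = PiC UNIV (\<lambda>_. C)"
  have inC: "apply_bcontfun y t \<in> C" if "y \<in> S" for y t
    using that by (auto simp: S_def mem_PiC_iff)
  have inK: "f (apply_bcontfun y t, u, d t) \<in> cball 0 B" if "y \<in> S" "a \<le> t" for y t
    using B(2)[of "(apply_bcontfun y t, u, d t)"] that inC d a by simp
  have int: "(\<lambda>\<tau>. f (apply_bcontfun y \<tau>, u, d \<tau>)) integrable_on {a..t}" if "y \<in> S" for y t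
  proof (rule integrable_along_curve[OF fc D dm d a])
    show "norm (apply_bcontfun y r) \<le> norm y0 + 1" for r
      using inC[OF that, of r] norm_triangle_ineq2[of "apply_bcontfun y r" y0]
      by (simp add: C_def dist_norm norm_minus_commute)
  qed auto
  have \<Phi>C: "\<Phi> (apply_bcontfun y) t \<in> C" if "y \<in> S" for y t
  proof -
    have "norm (J (apply_bcontfun y) (c t)) \<le> B * (c t - a)"
      unfolding J_def
      using has_integral_bound[OF _ integrable_integral[OF int[OF that, of "c t"], folded box_real(2)], of B]
        B(1) inK[OF that] c by (simp)
    also have "\<dots> \<le> B * \<delta>" using B(1) c[of t] by simp
    also have "\<dots> \<le> 1" using \<delta> by (simp add: mult.commute)
    finally show ?thesis by (simp add: C_def \<Phi>_def dist_norm)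
  qed
  have \<Phi>b: "\<Phi> (apply_bcontfun y) \<in> bcontfun" if "y \<in> S" for y
  proof -
    have "continuous_on {a..a+\<delta>} (J (apply_bcontfun y))"
      unfolding J_def by (rule indefinite_integral_continuous_1[OF int[OF that]])
    then have "continuous_on UNIV (\<Phi> (apply_bcontfun y))"
      unfolding \<Phi>_def using c
      by (intro continuous_intros continuous_on_compose2[OF _ cc]) auto
    moreover have "bounded (range (\<Phi> (apply_bcontfun y)))"
      by (rule bounded_subset[of C]) (use \<Phi>C[OF that] in \<open>auto simp: C_def\<close>)
    ultimately show ?thesis by (simp add: bcontfun_def)
  qed
  define P where "P y = Bcontfun (\<Phi> (apply_bcontfun y))" for y
  have P: "apply_bcontfun (P y) = \<Phi> (apply_bcontfun y)" if "y \<in> S" for y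
    unfolding P_def by (rule Bcontfun_inverse[OF \<Phi>b[OF that]])
  have "\<exists>!y\<in>S. P y = y"
  proof (rule Banach_fix)
    have "closed S" unfolding S_def by (rule closed_PiC) (simp add: C_def)
    then show "complete S" by (simp add: complete_eq_closed)
    have "const_bcontfun y0 \<in> S" by (simp add: S_def mem_PiC_iff C_def const_bcontfun.rep_eq)
    then show "S \<noteq> {}" by blast
    show "P ` S \<subseteq> S" using \<Phi>C by (auto simp: S_def mem_PiC_iff P[unfolded S_def])
    fix y z assume yz: "y \<in> S" "z \<in> S"
    show "dist (P y) (P z) \<le> 1 / 2 * dist y z"
    proof (rule dist_bound)
      fix t
      have "norm (J (apply_bcontfun y) (c t) - J (apply_bcontfun z) (c t))
          = norm (integral {a..c t} (\<lambda>\<tau>. f (apply_bcontfun y \<tau>, u, d \<tau>) - f (apply_bcontfun z \<tau>, u, d \<tau>)))"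
        unfolding J_def using yz int by (simp add: integral_diff)
      also have "\<dots> \<le> (L * dist y z) * (c t - a)"
      proof -
        have "norm (f (apply_bcontfun y \<tau>, u, d \<tau>) - f (apply_bcontfun z \<tau>, u, d \<tau>)) \<le> L * dist y z"
          if "a \<le> \<tau>" for \<tau>
        proof -
          have "norm (f (apply_bcontfun y \<tau>, u, d \<tau>) - f (apply_bcontfun z \<tau>, u, d \<tau>))
              \<le> L * norm (apply_bcontfun y \<tau> - apply_bcontfun z \<tau>)"
            using L(2)[of "apply_bcontfun y \<tau>" "apply_bcontfun z \<tau>" "(u, d \<tau>)"] inC yz d[of \<tau>] a that
            by simp
          also have "\<dots> \<le> L * dist y z"
            using dist_bounded[of y \<tau> z] L(1) by (simp add: dist_norm)
          finally show ?thesis .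
        qed
        then show ?thesis
          using has_integral_bound[OF _ integrable_integral[OF integrable_diff[OF int[OF yz(1), of "c t"]
                int[OF yz(2), of "c t"]], folded box_real(2)], of "L * dist y z"] L(1) c
          by simp
      qed
      also have "\<dots> \<le> (L * dist y z) * \<delta>" using L(1) c[of t] by (intro mult_left_mono) auto
      also have "\<dots> = \<delta> * L * dist y z" by simp
      also have "\<dots> \<le> 1 / 2 * dist y z" using \<delta> by (intro mult_right_mono) auto
      finally show "dist (apply_bcontfun (P y) t) (apply_bcontfun (P z) t) \<le> 1 / 2 * dist y z"
        using yz by (simp add: P \<Phi>_def dist_norm)
    qed
  qed auto
  then obtain y where y: "y \<in> S" "P y = y" by blast
  have fix_y: "apply_bcontfun y t = y0 + J (apply_bcontfun y) (c t)" for t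
    using fun_cong[OF P[OF y(1)], of t] unfolding y(2) by (simp add: \<Phi>_def)
  have "caratheodory_solution (\<lambda>\<tau> y. f (y, u, d \<tau>)) (apply_bcontfun y) a (a + \<delta>)"
  proof (rule caratheodory_solution_integral)
    show "(\<lambda>\<tau>. f (apply_bcontfun y \<tau>, u, d \<tau>)) integrable_on {a..a + \<delta>}" by (rule int[OF y(1)])
    fix t assume "a \<le> t" "t \<le> a + \<delta>"
    then show "apply_bcontfun y t = y0 + integral {a..t} (\<lambda>\<tau>. f (apply_bcontfun y \<tau>, u, d \<tau>))"
      using fix_y[of t] by (simp add: c_def J_def)
  qed
  moreover have "apply_bcontfun y a = y0" using fix_y[of a] \<delta> by (simp add: c_def J_def)
  ultimately show ?thesis using \<delta> by blast
qed

subsection \<open>Inter-event times\<close>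

lemma SUP_attained:
  fixes \<phi> :: "real \<Rightarrow> real"
  assumes "continuous_on {s..t} \<phi>" "s \<le> t"
  obtains \<tau> where "\<tau> \<in> {s..t}" "(SUP r\<in>{s..t}. \<phi> r) = \<phi> \<tau>" "\<And>r. r \<in> {s..t} \<Longrightarrow> \<phi> r \<le> \<phi> \<tau>"
proof -
  obtain \<tau> where \<tau>: "\<tau> \<in> {s..t}" "\<forall>r\<in>{s..t}. \<phi> r \<le> \<phi> \<tau>"
    using continuous_attains_sup[of "{s..t}" \<phi>] assms by auto
  have "(SUP r\<in>{s..t}. \<phi> r) = \<phi> \<tau>" by (rule cSup_eq_maximum) (use \<tau> in auto)
  then show ?thesis using that \<tau> by blast
qed

lemma sup_norm_on_attained:
  assumes "continuous_on {s..t} w" "s \<le> t"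
  obtains \<tau> where "\<tau> \<in> {s..t}" "sup_norm_on w s t = norm (w \<tau>)"
    "\<And>r. r \<in> {s..t} \<Longrightarrow> norm (w r) \<le> norm (w \<tau>)"
  using SUP_attained[OF continuous_on_norm[OF assms(1)] assms(2)] unfolding sup_norm_on_def by metis

lemma norm_le_sup_norm_on:
  assumes "continuous_on {s..t} w" "r \<in> {s..t}"
  shows "norm (w r) \<le> sup_norm_on w s t"
proof -
  have "s \<le> t" using assms(2) by simp
  then show ?thesis using sup_norm_on_attained[OF assms(1)] assms(2) by metis
qed

lemma event_condition_cong:
  assumes "\<And>\<tau>. s \<le> \<tau> \<Longrightarrow> \<tau> \<le> t \<Longrightarrow> w \<tau> = w' \<tau>"
  shows "event_condition \<gamma> U w s t \<longleftrightarrow> event_condition \<gamma> U w' s t"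
proof -
  have "(\<lambda>\<tau>. norm (w \<tau>)) ` {s..t} = (\<lambda>\<tau>. norm (w' \<tau>)) ` {s..t}"
    "(\<lambda>\<tau>. U (w \<tau>)) ` {s..t} = (\<lambda>\<tau>. U (w' \<tau>)) ` {s..t}"
    using assms by (auto intro!: image_cong)
  then show ?thesis unfolding event_condition_def sup_norm_on_def by simp
qed

text \<open>Near 0 the Landau bound applies; on \<open>[r, B]\<close> monotonicity bounds the ratio
  of \<open>\<gamma>\<close> to \<open>\<alpha>\<close> by
  \<open>\<gamma> B / \<alpha> r\<close>.\<close>

lemma class_K_inf_bigo_le:
  assumes \<gamma>: "class_K_inf \<gamma>" and \<alpha>: "class_K_inf \<alpha>" and O: "\<gamma> \<in> O[at_right 0](\<alpha>)"
  shows "\<exists>C>0. \<forall>s. 0 \<le> s \<and> s \<le> B \<longrightarrow> \<gamma> s \<le> C * \<alpha> s"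
proof -
  from O obtain C where C: "C > 0" "eventually (\<lambda>s. norm (\<gamma> s) \<le> C * norm (\<alpha> s)) (at_right 0)"
    by (elim landau_o.bigE)
  then obtain r where r: "r > 0" "\<And>s. 0 < s \<Longrightarrow> s < r \<Longrightarrow> norm (\<gamma> s) \<le> C * norm (\<alpha> s)"
    unfolding eventually_at_right_field by auto
  define K where "K = max C (\<gamma> B / \<alpha> r)"
  have K: "K > 0" using C by (simp add: K_def)
  have \<alpha>r: "\<alpha> r > 0" using class_K_inf_pos[OF \<alpha>] r by simp
  have "\<gamma> s \<le> K * \<alpha> s" if s: "0 \<le> s" "s \<le> B" for s
  proof -
    have \<alpha>s: "0 \<le> \<alpha> s" and \<gamma>s: "0 \<le> \<gamma> s"
      using class_K_inf_nonneg[OF \<alpha> s(1)] class_K_inf_nonneg[OF \<gamma> s(1)] by auto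
    consider "s = 0" | "0 < s" "s < r" | "r \<le> s" using s by linarith
    then show ?thesis
    proof cases
      case 1
      then show ?thesis using class_K_inf_0[OF \<alpha>] class_K_inf_0[OF \<gamma>] by simp
    next
      case 2
      then have "\<gamma> s \<le> C * \<alpha> s" using r(2)[of s] \<alpha>s \<gamma>s by simp
      also have "\<dots> \<le> K * \<alpha> s" using \<alpha>s by (simp add: K_def mult_right_mono)
      finally show ?thesis .
    next
      case 3
      have "\<gamma> s \<le> \<gamma> B" using class_K_inf_mono[OF \<gamma> s] .
      also have "\<dots> = \<gamma> B / \<alpha> r * \<alpha> r" using \<alpha>r by simp
      also have "\<dots> \<le> K * \<alpha> r" using \<alpha>r by (intro mult_right_mono) (auto simp: K_def)
      also have "\<dots> \<le> K * \<alpha> s" using class_K_inf_mono[OF \<alpha> _ 3] r K by simp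
      finally show ?thesis .
    qed
  qed
  then show ?thesis using K by blast
qed

text \<open>Where the error norm attains its maximum \<open>M\<close>, \<open>U\<close> is at least
  \<open>\<alpha> M\<close>, so an event forces
  \<open>\<alpha> M \<le> 2 * (t - s) * C * \<alpha> M\<close>. The clause that \<open>M\<close> is
  nonzero permits cancellation, and \<open>C\<close> depends on \<open>B\<close> alone.\<close>

lemma event_condition_dwell_time:
  fixes U :: "real^'m \<Rightarrow> real"
  assumes \<gamma>: "class_K_inf \<gamma>" and \<alpha>: "class_K_inf \<alpha>" and O: "\<gamma> \<in> O[at_right 0](\<alpha>)"
    and Uc: "continuous_on UNIV U" and U: "\<And>w. \<alpha> (norm w) \<le> U w"
  shows "\<exists>\<delta>>0. \<forall>w s t. s \<le> t \<and> continuous_on {s..t} w \<and> (\<forall>\<tau>\<in>{s..t}. norm (w \<tau>) \<le> B) \<and>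
    event_condition \<gamma> U w s t \<longrightarrow> s + \<delta> \<le> t"
proof -
  obtain C where C: "C > 0" "\<And>s. 0 \<le> s \<Longrightarrow> s \<le> B \<Longrightarrow> \<gamma> s \<le> C * \<alpha> s"
    using class_K_inf_bigo_le[OF \<gamma> \<alpha> O] by blast
  have "s + 1 / (2 * C) \<le> t" if st: "s \<le> t" and wc: "continuous_on {s..t} w"
    and wB: "\<forall>\<tau>\<in>{s..t}. norm (w \<tau>) \<le> B" and ev: "event_condition \<gamma> U w s t" for w s t
  proof -
    let ?M = "sup_norm_on w s t"
    obtain \<tau> where \<tau>: "\<tau> \<in> {s..t}" "?M = norm (w \<tau>)"
      using sup_norm_on_attained[OF wc st] by metis
    have M: "0 < ?M" "?M \<le> B" using ev wB \<tau> by (auto simp: event_condition_def)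
    have "continuous_on {s..t} (\<lambda>r. U (w r))" using continuous_on_compose2[OF Uc wc] by simp
    then have "U (w \<tau>) \<le> (SUP r\<in>{s..t}. U (w r))"
      using SUP_attained[OF _ st, of "\<lambda>r. U (w r)"] \<tau>(1) by metis
    moreover have "\<alpha> ?M \<le> U (w \<tau>)" using U[of "w \<tau>"] \<tau> by simp
    ultimately have "\<alpha> ?M \<le> 2 * (t - s) * \<gamma> ?M" using ev by (simp add: event_condition_def)
    also have "\<dots> \<le> 2 * (t - s) * (C * \<alpha> ?M)" using C M st by (intro mult_left_mono) auto
    finally have "1 * \<alpha> ?M \<le> (2 * (t - s) * C) * \<alpha> ?M" by (simp add: algebra_simps)
    then have "1 \<le> 2 * (t - s) * C" using class_K_inf_pos[OF \<alpha> M(1)] by (rule mult_right_le_imp_le)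
    then show ?thesis using C(1) by (simp add: field_simps)
  qed
  then show ?thesis using C(1) by (intro exI[of _ "1 / (2 * C)"]) auto
qed

subsection \<open>Decay between samples\<close>

lemma cont_diff_has_frechet_derivative:
  assumes "cont_diff F"
  shows "(F has_derivative frechet_derivative F (at x)) (at x)"
proof -
  have "F differentiable (at x)"
    using assms unfolding cont_diff_def by (blast intro: differentiableI)
  then show ?thesis using frechet_derivative_works by blast
qed

text \<open>One disturbance and its bound are fixed. \<open>g\<close> is
  \<open>\<kappa> \<circ> h\<close>, and \<open>V\<close> stands for the function \<open>Vq\<close>
  of the theorem, not for its \<open>V\<close>. \<open>error_gain\<close> is what the two conditions
  on \<open>\<alpha>hat_w\<close> yield once \<open>\<alpha>hat_w\<close> is eliminated.\<close>

locale sampled_loop =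
  fixes f :: "(real^'n) \<times> (real^'m) \<times> (real^'d) \<Rightarrow> real^'n"
    and g :: "real^'n \<Rightarrow> real^'m" and D :: "(real^'d) set" and t0 dbar :: real
    and d :: "real \<Rightarrow> real^'d" and V :: "real^'n \<Rightarrow> real" and U :: "real^'m \<Rightarrow> real"
    and \<alpha>l_w \<alpha>u_w \<alpha>_w \<sigma>_w \<zeta>_w \<alpha>l_q \<alpha>u_q \<alpha>_q \<sigma>_q \<zeta>_q \<gamma> :: "real \<Rightarrow> real"
  assumes f: "cont_diff f"
    and g: "\<And>x. g differentiable (at x)"
    and D: "compact D"
    and d_measurable: "d \<in> borel_measurable (lebesgue_on {t0..})"
    and d: "\<And>t. t0 \<le> t \<Longrightarrow> d t \<in> D" "\<And>t. t0 \<le> t \<Longrightarrow> norm (d t) \<le> dbar"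
    and dbar: "0 < dbar"
    and V: "ISS_Lyapunov (closed_loop_field f g) D V \<alpha>l_q \<alpha>u_q \<alpha>_q \<sigma>_q \<zeta>_q"
    and U: "error_growth_bound (error_field f g) D U \<alpha>l_w \<alpha>u_w \<alpha>_w \<sigma>_w \<zeta>_w"
    and \<gamma>: "class_K_inf \<gamma>"
    and state_gain: "\<And>s. 0 < s \<Longrightarrow> 2 * \<sigma>_w s < \<alpha>_q s"
    and error_gain: "\<And>s. 0 < s \<Longrightarrow> \<sigma>_q s + 2 * \<alpha>_w s < 2 * \<gamma> s"
    and \<gamma>_bigo: "\<gamma> \<in> O[at_right 0](\<alpha>l_w)"
begin

abbreviation sol :: "real^'m \<Rightarrow> (real \<Rightarrow> real^'n) \<Rightarrow> real \<Rightarrow> real \<Rightarrow> bool" where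
  "sol u \<equiv> caratheodory_solution (\<lambda>\<tau> y. f (y, u, d \<tau>))"

abbreviation event :: "(real \<Rightarrow> real^'n) \<Rightarrow> real \<Rightarrow> real \<Rightarrow> bool" where
  "event x s t \<equiv> event_condition \<gamma> U (sampling_error g x s) s t"

text \<open>The total supply of a disturbance of size \<open>dbar\<close>: \<open>\<zeta>_q\<close>
  acts on \<open>V\<close> directly, \<open>\<zeta>_w\<close> through the growth of the error. It
  doubles as the guaranteed decay rate.\<close>

definition c :: real where "c = \<zeta>_q dbar + \<zeta>_w dbar"

text \<open>A level of \<open>V\<close> above which the dissipation is at least
  \<open>10 * c\<close>, because \<open>V\<close> is bounded by \<open>\<alpha>u_q\<close> of the
  norm.\<close>

definition vstar :: real where "vstar = \<alpha>u_q (inv_into {0..} \<alpha>_q (10 * c))"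

text \<open>Cited by position: 1 to 5 belong to \<open>U\<close>, 6 to 10 to \<open>V\<close>, each
  in the order lower bound, upper bound, rate, gain, disturbance gain.\<close>

lemma K_inf: "class_K_inf \<alpha>l_w" "class_K_inf \<alpha>u_w" "class_K_inf \<alpha>_w" "class_K_inf \<sigma>_w"
  "class_K_inf \<zeta>_w" "class_K_inf \<alpha>l_q" "class_K_inf \<alpha>u_q" "class_K_inf \<alpha>_q" "class_K_inf \<sigma>_q"
  "class_K_inf \<zeta>_q"
  using V U by (auto simp: ISS_Lyapunov_def error_growth_bound_def)

lemma f_continuous: "continuous_on UNIV f"
  using f by (rule cont_diff_continuous_on)

lemma V_continuous: "continuous_on UNIV V"
  using V by (simp add: ISS_Lyapunov_def cont_diff_continuous_on)

lemma U_continuous: "continuous_on UNIV U"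
  using U by (simp add: error_growth_bound_def cont_diff_continuous_on)

lemma g_continuous: "continuous_on UNIV g"
  using g by (meson continuous_at_imp_continuous_on differentiable_imp_continuous_within)

lemma continuous_on_g: "continuous_on S x \<Longrightarrow> continuous_on S (\<lambda>t. g (x t))"
  by (rule continuous_on_compose2[OF g_continuous]) auto

lemma continuous_on_sampling_error:
  assumes "continuous_on S x"
  shows "continuous_on S (sampling_error g x s)"
  unfolding sampling_error_def[abs_def]
  by (intro continuous_intros continuous_on_g assms)

lemma V_bounds: "\<alpha>l_q (norm x) \<le> V x" "V x \<le> \<alpha>u_q (norm x)" "0 \<le> V x"
  using V by (auto simp: ISS_Lyapunov_def)

lemma U_bounds: "\<alpha>l_w (norm w) \<le> U w" "0 \<le> U w"
  using U by (auto simp: error_growth_bound_def)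

lemma U_0: "U 0 = 0"
proof -
  have "U 0 \<le> \<alpha>u_w (norm (0::real^'m))" using U unfolding error_growth_bound_def by blast
  then show ?thesis using U_bounds(2)[of 0] class_K_inf_0[OF K_inf(2)] by simp
qed

lemma c_pos: "0 < c"
  using class_K_inf_pos[OF K_inf(10) dbar] class_K_inf_pos[OF K_inf(5) dbar] by (simp add: c_def)

text \<open>Cutting \<open>D\<close> with the ball keeps the disturbance values in a compact set on
  which both disturbance gains are at most their values at \<open>dbar\<close>.\<close>

lemma d_compact: "compact (D \<inter> cball 0 dbar)" "t0 \<le> t \<Longrightarrow> d t \<in> D \<inter> cball 0 dbar"
  using D d by (auto intro: compact_Int_closed)

lemma V_growth:
  assumes sol: "sol u x a b" and a: "t0 \<le> a" "a \<le> b"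
  shows "V (x b) \<le> V (x a)
    + integral {a..b} (\<lambda>t. - \<alpha>_q (norm (x t)) + \<sigma>_q (norm (u - g (x t))) + \<zeta>_q dbar)"
proof (rule growth_along_solution[OF sol f_continuous d_compact(1) _ _ _ _ a(2),
      where P = "\<lambda>y. - \<alpha>_q (norm y) + \<sigma>_q (norm (u - g y)) + \<zeta>_q dbar"
        and \<Phi>' = "\<lambda>y. frechet_derivative V (at y)"])
  show "d t \<in> D \<inter> cball 0 dbar" if "a \<le> t" for t using that a d_compact(2) by auto
  show "(V has_derivative frechet_derivative V (at y)) (at y)" for y
    using V by (intro cont_diff_has_frechet_derivative) (simp add: ISS_Lyapunov_def)
  fix y v assume v: "v \<in> D \<inter> cball 0 dbar"
  have "frechet_derivative V (at y) (closed_loop_field f g y (u - g y) v)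
      \<le> - \<alpha>_q (norm y) + \<sigma>_q (norm (u - g y)) + \<zeta>_q (norm v)"
    using V v by (auto simp: ISS_Lyapunov_def)
  moreover have "\<zeta>_q (norm v) \<le> \<zeta>_q dbar" using v by (intro class_K_inf_mono[OF K_inf(10)]) auto
  ultimately show "frechet_derivative V (at y) (f (y, u, v))
      \<le> - \<alpha>_q (norm y) + \<sigma>_q (norm (u - g y)) + \<zeta>_q dbar"
    by (simp add: closed_loop_field_def)
next
  have xc: "continuous_on {a..b} x" using sol by (rule caratheodory_solution_continuous_on)
  then show "continuous_on {a..b} (\<lambda>t. - \<alpha>_q (norm (x t)) + \<sigma>_q (norm (u - g (x t))) + \<zeta>_q dbar)"
    by (intro continuous_intros class_K_inf_continuous_on_norm K_inf continuous_on_g)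
qed

text \<open>With the input held at \<open>u\<close> the error is \<open>u - g y\<close>, a function
  of the state alone. The chain rule reproduces \<open>error_field\<close>, so no separate
  differential equation for the error is needed.\<close>

lemma U_growth:
  assumes sol: "sol u x a b" and a: "t0 \<le> a" "a \<le> b"
  shows "U (u - g (x b)) \<le> U (u - g (x a))
    + integral {a..b} (\<lambda>t. \<alpha>_w (norm (u - g (x t))) + \<sigma>_w (norm (x t)) + \<zeta>_w dbar)"
proof (rule growth_along_solution[OF sol f_continuous d_compact(1) _ _ _ _ a(2),
      where P = "\<lambda>y. \<alpha>_w (norm (u - g y)) + \<sigma>_w (norm y) + \<zeta>_w dbar"
        and \<Phi> = "\<lambda>y. U (u - g y)"
        and \<Phi>' = "\<lambda>y h. frechet_derivative U (at (u - g y)) (- frechet_derivative g (at y) h)"])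
  show "d t \<in> D \<inter> cball 0 dbar" if "a \<le> t" for t using that a d_compact(2) by auto
  fix y
  have "(U has_derivative frechet_derivative U (at w)) (at w)" for w
    using U by (intro cont_diff_has_frechet_derivative) (simp add: error_growth_bound_def)
  moreover have "(g has_derivative frechet_derivative g (at y)) (at y)"
    using g frechet_derivative_works by blast
  then have "((\<lambda>y. u - g y) has_derivative (\<lambda>h. - frechet_derivative g (at y) h)) (at y)"
    by (auto intro!: derivative_eq_intros)
  ultimately show "((\<lambda>y. U (u - g y)) has_derivative
      (\<lambda>h. frechet_derivative U (at (u - g y)) (- frechet_derivative g (at y) h))) (at y)"
    by (rule has_derivative_compose[rotated])
next
  fix y v assume v: "v \<in> D \<inter> cball 0 dbar"
  have "frechet_derivative U (at (u - g y)) (error_field f g y (u - g y) v)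
      \<le> \<alpha>_w (norm (u - g y)) + \<sigma>_w (norm y) + \<zeta>_w (norm v)"
    using U v by (auto simp: error_growth_bound_def)
  moreover have "\<zeta>_w (norm v) \<le> \<zeta>_w dbar" using v by (intro class_K_inf_mono[OF K_inf(5)]) auto
  ultimately show "frechet_derivative U (at (u - g y)) (- frechet_derivative g (at y) (f (y, u, v)))
      \<le> \<alpha>_w (norm (u - g y)) + \<sigma>_w (norm y) + \<zeta>_w dbar"
    by (simp add: error_field_def closed_loop_field_def)
next
  have xc: "continuous_on {a..b} x" using sol by (rule caratheodory_solution_continuous_on)
  then show "continuous_on {a..b} (\<lambda>t. \<alpha>_w (norm (u - g (x t))) + \<sigma>_w (norm (x t)) + \<zeta>_w dbar)"
    by (intro continuous_intros class_K_inf_continuous_on_norm K_inf continuous_on_g)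
qed

text \<open>While no event occurs, the supply \<open>\<sigma>_q\<close> of the error is paid for by the dissipation of the
  state, because the error can only have grown through \<open>\<sigma>_w\<close> and the disturbance.\<close>

lemma error_supply_le:
  assumes sol: "sol (g (x s)) x s t" and s: "t0 \<le> s" "s \<le> t" and no_event: "\<not> event x s t"
  shows "(t - s) * \<sigma>_q (sup_norm_on (sampling_error g x s) s t)
    \<le> integral {s..t} (\<lambda>\<tau>. \<alpha>_q (norm (x \<tau>)) / 2) + (t - s) * \<zeta>_w dbar"
proof -
  let ?w = "sampling_error g x s"
  define M where "M = sup_norm_on ?w s t"
  have xc: "continuous_on {s..t} x" using sol by (rule caratheodory_solution_continuous_on)
  have wc: "continuous_on {s..t} ?w" using xc by (rule continuous_on_sampling_error)
  have wM: "norm (?w r) \<le> M" if "r \<in> {s..t}" for r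
    unfolding M_def using norm_le_sup_norm_on[OF wc that] .
  have M0: "0 \<le> M" using wM[of s] s norm_ge_zero[of "?w s"] by (simp add: sampling_error_def)
  have \<alpha>_int: "(\<lambda>\<tau>. \<alpha>_q (norm (x \<tau>)) / 2) integrable_on {s..t}"
    by (intro integrable_continuous_real continuous_intros class_K_inf_continuous_on_norm K_inf xc) auto
  have A0: "0 \<le> integral {s..t} (\<lambda>\<tau>. \<alpha>_q (norm (x \<tau>)) / 2)"
    by (rule integral_nonneg[OF \<alpha>_int]) (simp add: class_K_inf_nonneg[OF K_inf(8)])
  show ?thesis
  \<comment> \<open>For \<open>M = 0\<close> the event condition fails by its second clause and says
    nothing about \<open>U\<close>; then \<open>\<sigma>_q M\<close> vanishes anyway.\<close>
  proof (cases "M = 0")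
    case True
    then show ?thesis
      using A0 s class_K_inf_0[OF K_inf(9)] class_K_inf_pos[OF K_inf(5) dbar] by (simp add: M_def)
  next
    case False
    have "continuous_on {s..t} (\<lambda>r. U (?w r))" using continuous_on_compose2[OF U_continuous wc] by simp
    then obtain \<tau> where \<tau>: "\<tau> \<in> {s..t}" "(SUP r\<in>{s..t}. U (?w r)) = U (?w \<tau>)"
      using SUP_attained[OF _ s(2)] by metis
    have "2 * (t - s) * \<gamma> M < U (?w \<tau>)"
      using no_event False \<tau>(2) by (simp add: event_condition_def M_def)
    also have "U (?w \<tau>) \<le> U (g (x s) - g (x s))
        + integral {s..\<tau>} (\<lambda>r. \<alpha>_w (norm (g (x s) - g (x r))) + \<sigma>_w (norm (x r)) + \<zeta>_w dbar)"
      unfolding sampling_error_def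
      using U_growth[OF caratheodory_solution_subinterval[OF sol order_refl], of \<tau>] \<tau>(1) s by auto
    also have "\<dots> \<le> 0 + integral {s..t} (\<lambda>r. \<alpha>_w (norm (g (x s) - g (x r))) + \<sigma>_w (norm (x r)) + \<zeta>_w dbar)"
    proof (rule add_mono)
      have "(\<lambda>r. \<alpha>_w (norm (g (x s) - g (x r))) + \<sigma>_w (norm (x r)) + \<zeta>_w dbar) integrable_on {s..t}"
        by (intro integrable_continuous_real continuous_intros class_K_inf_continuous_on_norm K_inf
            continuous_on_g xc)
      moreover have "0 \<le> \<alpha>_w (norm (g (x s) - g (x r))) + \<sigma>_w (norm (x r)) + \<zeta>_w dbar" for r
        by (intro add_nonneg_nonneg class_K_inf_nonneg[OF K_inf(3)] class_K_inf_nonneg[OF K_inf(4)]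
            class_K_inf_nonneg[OF K_inf(5)]) (use dbar in auto)
      ultimately show "integral {s..\<tau>} (\<lambda>r. \<alpha>_w (norm (g (x s) - g (x r))) + \<sigma>_w (norm (x r)) + \<zeta>_w dbar)
          \<le> integral {s..t} (\<lambda>r. \<alpha>_w (norm (g (x s) - g (x r))) + \<sigma>_w (norm (x r)) + \<zeta>_w dbar)"
        using \<tau>(1) by (intro integral_subset_le) (auto intro: integrable_subinterval_real)
    qed (simp add: U_0)
    also have "\<dots> \<le> integral {s..t} (\<lambda>r. \<alpha>_q (norm (x r)) / 2 + (\<alpha>_w M + \<zeta>_w dbar))"
      unfolding add_0
    proof (rule integral_le)
      show "(\<lambda>r. \<alpha>_w (norm (g (x s) - g (x r))) + \<sigma>_w (norm (x r)) + \<zeta>_w dbar) integrable_on {s..t}"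
        by (intro integrable_continuous_real continuous_intros class_K_inf_continuous_on_norm K_inf
            continuous_on_g xc)
      show "(\<lambda>r. \<alpha>_q (norm (x r)) / 2 + (\<alpha>_w M + \<zeta>_w dbar)) integrable_on {s..t}"
        by (intro integrable_add \<alpha>_int integrable_const_ivl)
      fix r assume r: "r \<in> {s..t}"
      have "\<alpha>_w (norm (g (x s) - g (x r))) \<le> \<alpha>_w M"
        using wM[OF r] by (intro class_K_inf_mono[OF K_inf(3)]) (auto simp: sampling_error_def)
      moreover have "2 * \<sigma>_w (norm (x r)) \<le> \<alpha>_q (norm (x r))"
        using state_gain[of "norm (x r)"] class_K_inf_0[OF K_inf(4)] class_K_inf_0[OF K_inf(8)]
        by (cases "x r = 0") auto
      ultimately show "\<alpha>_w (norm (g (x s) - g (x r))) + \<sigma>_w (norm (x r)) + \<zeta>_w dbar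
          \<le> \<alpha>_q (norm (x r)) / 2 + (\<alpha>_w M + \<zeta>_w dbar)" by linarith
    qed
    also have "\<dots> = integral {s..t} (\<lambda>r. \<alpha>_q (norm (x r)) / 2) + (t - s) * (\<alpha>_w M + \<zeta>_w dbar)"
      by (subst integral_add[OF \<alpha>_int integrable_const_ivl]) (use s in simp)
    finally have *: "2 * (t - s) * \<gamma> M < integral {s..t} (\<lambda>r. \<alpha>_q (norm (x r)) / 2)
        + (t - s) * (\<alpha>_w M + \<zeta>_w dbar)" .
    \<comment> \<open>The factor 2 of the sampling law enters here: \<open>2 * \<gamma>\<close>
      covers \<open>\<sigma>_q\<close> together with the self-growth \<open>\<alpha>_w\<close> of
      the error, which then cancels.\<close>
    have "(t - s) * (\<sigma>_q M + \<alpha>_w M) \<le> (t - s) * (2 * \<gamma> M)"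
    proof (rule mult_left_mono)
      have "0 \<le> \<alpha>_w M" using M0 by (rule class_K_inf_nonneg[OF K_inf(3)])
      then show "\<sigma>_q M + \<alpha>_w M \<le> 2 * \<gamma> M" using error_gain[of M] False M0 by simp
    qed (use s in simp)
    with * show ?thesis by (simp add: M_def algebra_simps)
  qed
qed

lemma le_\<alpha>_q_of_vstar_le:
  assumes "vstar \<le> V y"
  shows "10 * c \<le> \<alpha>_q (norm y)"
proof -
  have c: "0 \<le> 10 * c" using c_pos by simp
  note inv = class_K_inf_inv[OF K_inf(8) c]
  have "\<alpha>u_q (inv_into {0..} \<alpha>_q (10 * c)) \<le> \<alpha>u_q (norm y)"
    using assms V_bounds(2)[of y] by (simp add: vstar_def)
  then have "inv_into {0..} \<alpha>_q (10 * c) \<le> norm y"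
    using class_K_inf_less[OF K_inf(7), of "norm y" "inv_into {0..} \<alpha>_q (10 * c)"] by fastforce
  then show ?thesis using class_K_inf_mono[OF K_inf(8) inv(1), of "norm y"] inv(2) by simp
qed

text \<open>Either the state dissipates much, or the error has been small since the sample and the
  Lyapunov inequality with a small input applies on the whole interval.\<close>

lemma decay_without_event:
  assumes sol: "sol (g (x s)) x s t" and s: "t0 \<le> s" "s \<le> t" and no_event: "\<not> event x s t"
  shows "V (x t) \<le> max vstar (V (x s) - c * (t - s))"
proof -
  let ?w = "sampling_error g x s"
  define M where "M = sup_norm_on ?w s t"
  define A where "A = integral {s..t} (\<lambda>\<tau>. \<alpha>_q (norm (x \<tau>)) / 2)"
  have xc: "continuous_on {s..t} x" using sol by (rule caratheodory_solution_continuous_on)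
  have wc: "continuous_on {s..t} ?w" using xc by (rule continuous_on_sampling_error)
  have wM: "norm (?w r) \<le> M" if "r \<in> {s..t}" for r
    unfolding M_def using norm_le_sup_norm_on[OF wc that] .
  have \<alpha>_int: "(\<lambda>\<tau>. \<alpha>_q (norm (x \<tau>))) integrable_on {r..t}" if "s \<le> r" for r
    by (rule integrable_subinterval_real[of _ s t])
      (use that in \<open>auto intro!: integrable_continuous_real class_K_inf_continuous_on_norm K_inf xc\<close>)
  have A0: "0 \<le> A" unfolding A_def
    by (rule integral_nonneg) (use \<alpha>_int[of s] in \<open>auto intro: class_K_inf_nonneg[OF K_inf(8)]\<close>)
  \<comment> \<open>The starting time \<open>r\<close> is free, but \<open>M\<close> remains the
    supremum over all of \<open>[s, t]\<close>: the second case restarts the estimate at a crossing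
    of \<open>vstar\<close>.\<close>
  have est: "V (x t) \<le> V (x r) + (t - r) * (\<sigma>_q M + \<zeta>_q dbar) - integral {r..t} (\<lambda>\<tau>. \<alpha>_q (norm (x \<tau>)))"
    if r: "r \<in> {s..t}" for r
  proof -
    have "V (x t) \<le> V (x r)
        + integral {r..t} (\<lambda>\<tau>. - \<alpha>_q (norm (x \<tau>)) + \<sigma>_q (norm (g (x s) - g (x \<tau>))) + \<zeta>_q dbar)"
      by (rule V_growth[OF caratheodory_solution_subinterval[OF sol]]) (use r s in auto)
    also have "integral {r..t} (\<lambda>\<tau>. - \<alpha>_q (norm (x \<tau>)) + \<sigma>_q (norm (g (x s) - g (x \<tau>))) + \<zeta>_q dbar)
        \<le> integral {r..t} (\<lambda>\<tau>. (\<sigma>_q M + \<zeta>_q dbar) - \<alpha>_q (norm (x \<tau>)))"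
    proof (rule integral_le)
      have "continuous_on {r..t} x" by (rule continuous_on_subset[OF xc]) (use r in auto)
      then show "(\<lambda>\<tau>. - \<alpha>_q (norm (x \<tau>)) + \<sigma>_q (norm (g (x s) - g (x \<tau>))) + \<zeta>_q dbar) integrable_on {r..t}"
        by (intro integrable_continuous_real continuous_intros class_K_inf_continuous_on_norm K_inf
            continuous_on_g)
      show "(\<lambda>\<tau>. (\<sigma>_q M + \<zeta>_q dbar) - \<alpha>_q (norm (x \<tau>))) integrable_on {r..t}"
        using r by (intro integrable_diff \<alpha>_int integrable_const_ivl) auto
      fix \<tau> assume "\<tau> \<in> {r..t}"
      then have "\<sigma>_q (norm (g (x s) - g (x \<tau>))) \<le> \<sigma>_q M"
        using wM[of \<tau>] r by (intro class_K_inf_mono[OF K_inf(9)]) (auto simp: sampling_error_def)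
      then show "- \<alpha>_q (norm (x \<tau>)) + \<sigma>_q (norm (g (x s) - g (x \<tau>))) + \<zeta>_q dbar
          \<le> (\<sigma>_q M + \<zeta>_q dbar) - \<alpha>_q (norm (x \<tau>))" by simp
    qed
    also have "\<dots> = (t - r) * (\<sigma>_q M + \<zeta>_q dbar) - integral {r..t} (\<lambda>\<tau>. \<alpha>_q (norm (x \<tau>)))"
      by (subst integral_diff[OF integrable_const_ivl \<alpha>_int]) (use r in auto)
    finally show ?thesis by simp
  qed
  have supply_le: "(t - s) * \<sigma>_q M \<le> A + (t - s) * \<zeta>_w dbar"
    unfolding M_def A_def by (rule error_supply_le[OF sol s no_event])
  show ?thesis
  \<comment> \<open>The net bound \<open>V (x s) + c * (t - s) - A\<close> falls at rate at least
    \<open>2 * c\<close> in the first case. In the second, \<open>A\<close> is small enough to make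
    the error small.\<close>
  proof (cases "3 * c * (t - s) \<le> A")
    case True
    have "integral {s..t} (\<lambda>\<tau>. \<alpha>_q (norm (x \<tau>))) = 2 * A" by (simp add: A_def)
    then have "V (x t) \<le> V (x s) + (t - s) * (\<sigma>_q M + \<zeta>_q dbar) - 2 * A"
      using est[of s] s by simp
    also have "\<dots> \<le> V (x s) + c * (t - s) - A"
      using supply_le by (simp add: c_def algebra_simps)
    also have "\<dots> \<le> V (x s) - c * (t - s)"
    proof -
      have "0 \<le> c * (t - s)" using c_pos s by simp
      then show ?thesis using True by (simp add: algebra_simps)
    qed
    finally show ?thesis by simp
  next
    case False
    have "s < t" using False A0 s by (cases "s = t") auto
    have "(t - s) * \<sigma>_q M \<le> (t - s) * (4 * c)"
    proof -
      have "\<zeta>_w dbar \<le> c" using class_K_inf_pos[OF K_inf(10) dbar] by (simp add: c_def)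
      then have "(t - s) * \<zeta>_w dbar \<le> (t - s) * c" using s by (intro mult_left_mono) auto
      then show ?thesis using supply_le False by (simp add: algebra_simps)
    qed
    then have \<sigma>M: "\<sigma>_q M \<le> 4 * c" using \<open>s < t\<close> by simp
    have "\<zeta>_q dbar \<le> c" using class_K_inf_pos[OF K_inf(5) dbar] by (simp add: c_def)
    then have 5: "\<sigma>_q M + \<zeta>_q dbar \<le> 5 * c" using \<sigma>M by simp
    have dec: "V (x t) \<le> V (x r) - 5 * c * (t - r)"
      if r: "r \<in> {s..t}" and above: "\<And>\<tau>. \<tau> \<in> {r..t} \<Longrightarrow> vstar \<le> V (x \<tau>)" for r
    proof -
      have "integral {r..t} (\<lambda>\<tau>. 10 * c) \<le> integral {r..t} (\<lambda>\<tau>. \<alpha>_q (norm (x \<tau>)))"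
        by (rule integral_le[OF integrable_const_ivl \<alpha>_int]) (use r above le_\<alpha>_q_of_vstar_le in auto)
      then have "(t - r) * (10 * c) \<le> integral {r..t} (\<lambda>\<tau>. \<alpha>_q (norm (x \<tau>)))"
        using r by (simp add: algebra_simps)
      moreover have "(t - r) * (\<sigma>_q M + \<zeta>_q dbar) \<le> (t - r) * (5 * c)"
        using r 5 by (intro mult_left_mono) auto
      ultimately show ?thesis using est[OF r] by (simp add: algebra_simps)
    qed
    have Vc: "continuous_on {s..t} (\<lambda>\<tau>. V (x \<tau>))"
      using continuous_on_compose2[OF V_continuous xc] by simp
    show ?thesis
    proof (rule ccontr)
      assume "\<not> ?thesis"
      then have big: "vstar < V (x t)" "V (x s) - c * (t - s) < V (x t)" by auto
      \<comment> \<open>Times at or below the level \<open>vstar\<close>. If there are none,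
        \<open>V\<close> decreases on the whole interval; otherwise the part after the last of them
        is considered.\<close>
      define S where "S = {s..t} \<inter> (\<lambda>\<tau>. V (x \<tau>)) -` {..vstar}"
      show False
      proof (cases "S = {}")
        case True
        have "vstar \<le> V (x \<tau>)" if "\<tau> \<in> {s..t}" for \<tau>
          using True that by (auto simp: S_def not_le dest!: equals0D[of _ \<tau>])
        then have "V (x t) \<le> V (x s) - 5 * c * (t - s)" using dec[of s] s by simp
        moreover have "0 \<le> c * (t - s)" using c_pos s by simp
        ultimately show False using big(2) by simp
      next
        case False
        have "closed S" unfolding S_def by (intro continuous_closed_preimage Vc) auto
        moreover have bdd: "bdd_above S" unfolding S_def by (rule bdd_aboveI[of _ t]) auto
        ultimately have m: "Sup S \<in> S" using False by (intro closed_contains_Sup) auto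
        let ?m = "Sup S"
        \<comment> \<open>A time at exactly the level \<open>vstar\<close>, after which
          \<open>V\<close> stays at or above it. Decay from there contradicts
          \<open>vstar < V (x t)\<close>.\<close>
        have "\<exists>r\<ge>?m. r \<le> t \<and> V (x r) = vstar"
        proof (rule IVT')
          show "continuous_on {?m..t} (\<lambda>r. V (x r))"
            by (rule continuous_on_subset[OF Vc]) (use m in \<open>auto simp: S_def\<close>)
        qed (use m big in \<open>auto simp: S_def\<close>)
        then obtain r where r: "?m \<le> r" "r \<le> t" "V (x r) = vstar" by blast
        have "vstar \<le> V (x \<tau>)" if \<tau>: "\<tau> \<in> {r..t}" for \<tau>
        proof (rule ccontr)
          assume "\<not> ?thesis"
          then have "\<tau> \<in> S" using \<tau> r m by (auto simp: S_def)
          then have "\<tau> \<le> ?m" using bdd by (rule cSup_upper)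
          then have "\<tau> = r" using r \<tau> by simp
          with \<open>\<not> ?thesis\<close> r show False by simp
        qed
        then have "V (x t) \<le> vstar - 5 * c * (t - r)" using dec[of r] r m by (auto simp: S_def)
        moreover have "0 \<le> 5 * c * (t - r)" using c_pos r by simp
        ultimately show False using big(1) by simp
      qed
    qed
  qed
qed

text \<open>The next sampling instant may itself satisfy the event condition, so absence of events
  is available only before \<open>t\<close>; the bound passes to \<open>t\<close> by
  continuity.\<close>

lemma decay_between_events:
  assumes sol: "sol (g (x s)) x s t" and s: "t0 \<le> s" "s \<le> t"
    and no_event: "\<And>r. s \<le> r \<Longrightarrow> r < t \<Longrightarrow> \<not> event x s r"
  shows "V (x t) \<le> max vstar (V (x s) - c * (t - s))"
proof (cases "s = t")
  case False
  have xc: "continuous_on {s..t} x" using sol by (rule caratheodory_solution_continuous_on)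
  have cl: "closure {s..<t} = {s..t}" using False s by simp
  have "V (x t) - max vstar (V (x s) - c * (t - s)) \<le> 0"
  proof (rule continuous_le_on_closure[of "{s..<t}" "\<lambda>r. V (x r) - max vstar (V (x s) - c * (r - s))"])
    show "continuous_on (closure {s..<t}) (\<lambda>r. V (x r) - max vstar (V (x s) - c * (r - s)))"
      unfolding cl by (intro continuous_intros continuous_on_compose2[OF V_continuous xc]) auto
    show "t \<in> closure {s..<t}" unfolding cl using s by simp
    fix r assume r: "r \<in> {s..<t}"
    have "V (x r) \<le> max vstar (V (x s) - c * (r - s))"
      by (rule decay_without_event[OF caratheodory_solution_subinterval[OF sol]])
        (use r s no_event in auto)
    then show "V (x r) - max vstar (V (x s) - c * (r - s)) \<le> 0" by simp
  qed
  then show ?thesis by simp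
qed simp

end

text \<open>The supremum of \<open>U\<close> cannot drop as the interval grows, and the threshold
  side varies continuously, so a strict failure persists. With zero error the failure need not be
  strict and events may follow at once, whence \<open>nz\<close>.\<close>

lemma no_event_right:
  fixes U :: "real^'m \<Rightarrow> real"
  assumes \<gamma>: "class_K_inf \<gamma>" and U: "continuous_on UNIV U" and w: "continuous_on {s..e} w"
    and st: "s \<le> t" "t < e" and no_event: "\<not> event_condition \<gamma> U w s t"
    and nz: "sup_norm_on w s t \<noteq> 0"
  shows "\<exists>\<epsilon>>0. \<forall>r. t \<le> r \<and> r < t + \<epsilon> \<longrightarrow> r \<le> e \<and> \<not> event_condition \<gamma> U w s r"
proof -
  define M where "M = sup_norm_on w s t"
  have wt: "continuous_on {s..r} w" if "r \<le> e" for r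
    by (rule continuous_on_subset[OF w]) (use that in auto)
  have Uw: "continuous_on {s..r} (\<lambda>\<tau>. U (w \<tau>))" if "r \<le> e" for r
    using continuous_on_compose2[OF U wt[OF that]] by simp
  have wM: "norm (w r) \<le> M" if "r \<in> {s..t}" for r
    unfolding M_def using norm_le_sup_norm_on[OF wt that] st by simp
  have M0: "0 \<le> M" using wM[of s] st order.trans[OF norm_ge_zero] by simp
  obtain \<tau> where \<tau>: "\<tau> \<in> {s..t}" "(SUP r\<in>{s..t}. U (w r)) = U (w \<tau>)"
    using SUP_attained[OF Uw st(1)] st by (metis less_imp_le)
  \<comment> \<open>\<open>q \<eta>\<close> majorises the threshold side at all times before
    \<open>t + \<eta>\<close> at which the error norm has risen by at most
    \<open>\<eta>\<close>.\<close>
  define q where "q \<eta> = 2 * (t + \<eta> - s) * \<gamma> (M + \<eta>)" for \<eta>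
  have q0: "q 0 < U (w \<tau>)"
    using no_event nz \<tau>(2) by (simp add: event_condition_def q_def M_def)
  have "continuous_on {0..} q"
    unfolding q_def using M0
    by (intro continuous_intros continuous_on_compose2[OF class_K_inf_continuous_on[OF \<gamma> order_refl]]) auto
  then have "(q \<longlongrightarrow> q 0) (at 0 within {0..})" by (auto simp: continuous_on_def)
  then have "(q \<longlongrightarrow> q 0) (at_right 0)" by (rule tendsto_within_subset) auto
  then have "eventually (\<lambda>\<eta>. q \<eta> < U (w \<tau>)) (at_right 0)"
    using q0 by (rule order_tendstoD(2))
  then obtain \<eta>0 where "\<eta>0 > 0" "\<And>\<eta>. 0 < \<eta> \<Longrightarrow> \<eta> < \<eta>0 \<Longrightarrow> q \<eta> < U (w \<tau>)"
    unfolding eventually_at_right_field by auto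
  then obtain \<eta> where \<eta>: "0 < \<eta>" "q \<eta> < U (w \<tau>)" using dense by blast
  have "(w \<longlongrightarrow> w t) (at t within {s..e})" using w st by (auto simp: continuous_on_def)
  then obtain \<epsilon>1 where \<epsilon>1: "\<epsilon>1 > 0"
    "\<And>r. r \<in> {s..e} \<Longrightarrow> r \<noteq> t \<Longrightarrow> dist r t < \<epsilon>1 \<Longrightarrow> dist (w r) (w t) < \<eta>"
    using \<eta>(1) unfolding Lim_within by (metis zero_less_dist_iff)
  define \<epsilon> where "\<epsilon> = min \<epsilon>1 (min \<eta> (e - t))"
  have "\<epsilon> > 0" using \<epsilon>1 \<eta> st by (simp add: \<epsilon>_def)
  moreover have "r \<le> e \<and> \<not> event_condition \<gamma> U w s r" if r: "t \<le> r" "r < t + \<epsilon>" for r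
  proof -
    have re: "r \<le> e" using r by (simp add: \<epsilon>_def)
    have "norm (w p) \<le> M + \<eta>" if p: "p \<in> {s..r}" for p
    proof (cases "p \<le> t")
      case True
      then show ?thesis using wM[of p] p \<eta> by simp
    next
      case False
      then have "dist (w p) (w t) < \<eta>" using p r re \<epsilon>1(2)[of p] st by (auto simp: \<epsilon>_def dist_real_def)
      then show ?thesis using wM[of t] st norm_triangle_ineq2[of "w p" "w t"] by (simp add: dist_norm)
    qed
    then have Mr: "sup_norm_on w s r \<le> M + \<eta>"
      using sup_norm_on_attained[OF wt[OF re]] r st by (metis order.trans)
    have Mr0: "0 \<le> sup_norm_on w s r"
      using order.trans[OF norm_ge_zero norm_le_sup_norm_on[OF wt[OF re], of s]] r st by simp
    have "2 * (r - s) * \<gamma> (sup_norm_on w s r) \<le> q \<eta>"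
      unfolding q_def using r st class_K_inf_mono[OF \<gamma> Mr0 Mr] class_K_inf_nonneg[OF \<gamma> Mr0]
      by (intro mult_mono) (auto simp: \<epsilon>_def)
    also have "q \<eta> < U (w \<tau>)" by (rule \<eta>(2))
    also have "U (w \<tau>) \<le> (SUP p\<in>{s..r}. U (w p))"
    proof -
      obtain p where "(SUP p\<in>{s..r}. U (w p)) = U (w p)" "\<And>r'. r' \<in> {s..r} \<Longrightarrow> U (w r') \<le> U (w p)"
        using SUP_attained[OF Uw[OF re]] r st by (metis order.trans)
      then show ?thesis using \<tau>(1) r by simp
    qed
    finally show ?thesis using re by (simp add: event_condition_def)
  qed
  ultimately show ?thesis by blast
qed

subsection \<open>Sampling instants\<close>

declare sampling_instant.simps(2) [simp del]

context sampled_loop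
begin

abbreviation inst :: "ereal \<Rightarrow> (real \<Rightarrow> real^'n) \<Rightarrow> nat \<Rightarrow> ereal" where
  "inst \<equiv> sampling_instant g \<gamma> U t0"

abbreviation traj :: "ereal \<Rightarrow> (real \<Rightarrow> real^'n) \<Rightarrow> bool" where
  "traj \<equiv> closed_loop_trajectory f g \<gamma> U d t0"

lemma inst_Suc_geI:
  assumes "inst T x k = ereal s"
    and "\<And>t. s \<le> t \<Longrightarrow> ereal t < T \<Longrightarrow> event x s t \<Longrightarrow> e \<le> ereal t"
  shows "e \<le> inst T x (Suc k)"
  using assms by (auto simp: sampling_instant.simps(2) Let_def intro!: INF_greatest)

lemma inst_Suc_le:
  assumes "inst T x k = ereal s" "s \<le> t" "ereal t < T" "event x s t"
  shows "inst T x (Suc k) \<le> ereal t"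
  using assms by (auto simp: sampling_instant.simps(2) Let_def intro!: INF_lower)

lemma inst_le_Suc: "inst T x k \<le> inst T x (Suc k)"
  by (auto simp: sampling_instant.simps(2) Let_def intro!: INF_greatest)

lemma inst_mono: "j \<le> k \<Longrightarrow> inst T x j \<le> inst T x k"
  by (rule lift_Suc_mono_le[of "inst T x"]) (rule inst_le_Suc)

lemma inst_cases:
  obtains "inst T x k = \<infinity>" | s where "t0 \<le> s" "inst T x k = ereal s"
  using inst_mono[of 0 k T x] by (cases "inst T x k") auto

lemma inst_Suc_infinity: "inst T x k = \<infinity> \<Longrightarrow> inst T x (Suc k) = \<infinity>"
  using inst_le_Suc[of T x k] by simp

lemma inst_Suc_less_or_infinity: "inst T x (Suc k) < T \<or> inst T x (Suc k) = \<infinity>"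
proof -
  define E where "E = {t. inst T x k \<le> ereal t \<and> ereal t < T \<and>
    event x (real_of_ereal (inst T x k)) t}"
  have *: "inst T x (Suc k) = (INF t\<in>E. ereal t)" by (simp add: E_def sampling_instant.simps(2) Let_def)
  show ?thesis
  proof (cases "E = {}")
    case True
    then show ?thesis unfolding * by (simp add: top_ereal_def)
  next
    case False
    then obtain t where t: "t \<in> E" by blast
    then have "inst T x (Suc k) \<le> ereal t" unfolding * by (rule INF_lower)
    also have "\<dots> < T" using t by (simp add: E_def)
    finally show ?thesis by simp
  qed
qed

lemma event_cong:
  assumes "\<And>\<tau>. s \<le> \<tau> \<Longrightarrow> \<tau> \<le> t \<Longrightarrow> x \<tau> = x' \<tau>" "s \<le> t"
  shows "event x s t \<longleftrightarrow> event x' s t"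
  by (rule event_condition_cong) (use assms in \<open>simp add: sampling_error_def\<close>)

text \<open>An event at \<open>t\<close> depends on the curve up to \<open>t\<close> only, so a
  shorter horizon merely turns the instants from \<open>T\<close> on into
  \<open>\<infinity>\<close>. As instants carry their horizon, truncation, prolongation and gluing
  all rest on this.\<close>

lemma inst_restrict:
  assumes T: "T \<le> T'" "ereal t0 < T" and x: "\<And>t. t0 \<le> t \<Longrightarrow> ereal t < T \<Longrightarrow> x' t = x t"
  shows "inst T x k = (if inst T' x' k < T then inst T' x' k else \<infinity>)"
proof (induction k)
  case 0
  then show ?case using T by simp
next
  case (Suc k)
  show ?case
  proof (cases "inst T' x' k < T")
    case False
    then have "inst T x (Suc k) = \<infinity>" using Suc by (intro inst_Suc_infinity) simp
    moreover have "\<not> inst T' x' (Suc k) < T" using False inst_le_Suc[of T' x' k] by simp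
    ultimately show ?thesis by simp
  next
    case True
    then obtain s where s: "t0 \<le> s" "inst T' x' k = ereal s" by (cases rule: inst_cases[of T' x' k]) auto
    then have s': "inst T x k = ereal s" using Suc True by simp
    have ev: "event x s t \<longleftrightarrow> event x' s t" if "s \<le> t" "ereal t < T" for t
    proof (rule event_cong[OF _ that(1)])
      fix \<tau> assume "s \<le> \<tau>" "\<tau> \<le> t"
      moreover have "ereal \<tau> < T" using \<open>\<tau> \<le> t\<close> that(2) by (meson ereal_less_eq(3) le_less_trans)
      ultimately show "x \<tau> = x' \<tau>" using x s by simp
    qed
    define N where "N = inst T x (Suc k)"
    define N' where "N' = inst T' x' (Suc k)"
    have ge: "N' \<le> N"
      unfolding N_def
    proof (rule inst_Suc_geI[OF s'])
      fix t assume "s \<le> t" "ereal t < T" "event x s t"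
      then show "N' \<le> ereal t"
        unfolding N'_def using ev T by (intro inst_Suc_le[OF s(2)]) auto
    qed
    show ?thesis
    proof (cases "N' < T")
      case True
      have "N \<le> N'"
      proof (rule ccontr)
        assume not: "\<not> N \<le> N'"
        \<comment> \<open>Events in \<open>[T, T')\<close> are invisible to the short horizon and
          are known only to be at least \<open>T\<close>; hence the minimum.\<close>
        have "min T N \<le> N'"
          unfolding N'_def
        proof (rule inst_Suc_geI[OF s(2)])
          fix t assume t: "s \<le> t" "ereal t < T'" "event x' s t"
          show "min T N \<le> ereal t"
          proof (cases "ereal t < T")
            case True
            then have "N \<le> ereal t" unfolding N_def using ev t by (intro inst_Suc_le[OF s']) auto
            then show ?thesis by (simp add: min_le_iff_disj)
          qed (simp add: not_less min_le_iff_disj)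
        qed
        with True not show False by (auto simp: min_le_iff_disj)
      qed
      with ge True show ?thesis unfolding N_def[symmetric] N'_def[symmetric] by simp
    next
      case False
      then have "\<not> N < T" using ge by simp
      then have "N = \<infinity>" using inst_Suc_less_or_infinity[of T x k] unfolding N_def by blast
      then show ?thesis using False unfolding N_def[symmetric] N'_def[symmetric] by simp
    qed
  qed
qed

subsection \<open>A priori bounds\<close>

lemma traj_sol:
  assumes "traj T x" "inst T x k = ereal s" "ereal b \<le> inst T x (Suc k)" "ereal b < T"
  shows "sol (g (x s)) x s b"
  unfolding caratheodory_solution_def
proof (intro allI impI)
  fix r1 r2 assume r: "s \<le> r1 \<and> r1 \<le> r2 \<and> r2 \<le> b"
  have "ereal r2 \<le> ereal b" using r by simp
  then have "inst T x k \<le> ereal r1 \<and> r1 \<le> r2 \<and> ereal r2 \<le> inst T x (Suc k) \<and> ereal r2 < T"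
    using assms(2) r order.trans[OF _ assms(3)] le_less_trans[OF _ assms(4)] by simp
  then have "((\<lambda>\<tau>. f (x \<tau>, g (x (real_of_ereal (inst T x k))), d \<tau>)) has_integral (x r2 - x r1)) {r1..r2}"
    using assms(1) unfolding closed_loop_trajectory_def by blast
  then show "((\<lambda>\<tau>. f (x \<tau>, g (x s), d \<tau>)) has_integral (x r2 - x r1)) {r1..r2}"
    using assms(2) by simp
qed

text \<open>The clause \<open>T \<le> (SUP k. ...)\<close> of a trajectory puts each time before
  \<open>T\<close> below some instant, so induction on the index reaches it. The step may stop
  anywhere up to the next instant.\<close>

lemma traj_induct:
  assumes "traj T x" "t0 \<le> t" "ereal t < T" "P t0"
    and step: "\<And>k s t. t0 \<le> s \<Longrightarrow> inst T x k = ereal s \<Longrightarrow> s < t \<Longrightarrow> ereal t < T \<Longrightarrow>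
      ereal t \<le> inst T x (Suc k) \<Longrightarrow> P s \<Longrightarrow> P t"
  shows "P t"
proof -
  have *: "P t" if "t0 \<le> t" "ereal t < T" "ereal t \<le> inst T x k" for k t
    using that
  proof (induction k arbitrary: t)
    case 0
    then show ?case using assms(4) by simp
  next
    case (Suc k)
    show ?case
    proof (cases "ereal t \<le> inst T x k")
      case True
      then show ?thesis using Suc by blast
    next
      case False
      then obtain s where s: "t0 \<le> s" "inst T x k = ereal s"
        by (cases rule: inst_cases[of T x k]) auto
      then have "s < t" using False by simp
      then have "ereal s < T" using Suc.prems(2) by (meson ereal_less_eq(3) le_less_trans less_imp_le)
      then have "P s" using Suc.IH[of s] s by simp
      then show ?thesis using step[OF s \<open>s < t\<close>] Suc.prems by blast
    qed
  qed
  have "ereal t < (SUP k. inst T x k)"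
    using assms(1,3) unfolding closed_loop_trajectory_def by (blast intro: less_le_trans)
  then obtain k where "ereal t < inst T x k" by (auto simp: less_SUP_iff)
  then show ?thesis using * assms(2,3) less_imp_le by blast
qed

lemma traj_continuous_on:
  assumes "traj T x" "ereal t < T"
  shows "continuous_on {t0..t} x"
proof (cases "t0 \<le> t")
  case True
  show ?thesis
  proof (rule traj_induct[OF assms(1) True assms(2)])
    fix k s t
    assume s: "t0 \<le> s" "inst T x k = ereal s" "s < t" "ereal t < T" "ereal t \<le> inst T x (Suc k)"
      and IH: "continuous_on {t0..s} x"
    have "continuous_on {s..t} x"
      by (rule caratheodory_solution_continuous_on[OF traj_sol[OF assms(1) s(2) s(5) s(4)]])
    then have "continuous_on ({t0..s} \<union> {s..t}) x" using IH by (intro continuous_on_closed_Un) auto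
    moreover have "{t0..s} \<union> {s..t} = {t0..t}" using s by auto
    ultimately show "continuous_on {t0..t} x" by simp
  qed simp
qed simp

lemma traj_decay:
  assumes "traj T x" "t0 \<le> t" "ereal t < T"
  shows "V (x t) \<le> max vstar (V (x t0) - c * (t - t0))"
proof (rule traj_induct[OF assms])
  fix k s t
  assume s: "t0 \<le> s" "inst T x k = ereal s" "s < t" "ereal t < T" "ereal t \<le> inst T x (Suc k)"
    and IH: "V (x s) \<le> max vstar (V (x t0) - c * (s - t0))"
  have "V (x t) \<le> max vstar (V (x s) - c * (t - s))"
  proof (rule decay_between_events[OF traj_sol[OF assms(1) s(2) s(5) s(4)]])
    fix r assume r: "s \<le> r" "r < t"
    show "\<not> event x s r"
    proof
      assume "event x s r"
      moreover have "ereal r < T" using r s by (meson ereal_less_eq(3) le_less_trans less_imp_le)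
      ultimately have "inst T x (Suc k) \<le> ereal r" using inst_Suc_le[OF s(2) r(1)] by blast
      also have "\<dots> < ereal t" using r by simp
      finally show False using s(5) by simp
    qed
  qed (use s in auto)
  \<comment> \<open>The floor \<open>vstar\<close> of the bound at \<open>s\<close> is lowered by
    this amount too, so the nested maxima collapse into one.\<close>
  moreover have "0 \<le> c * (t - s)" using c_pos s by simp
  ultimately show "V (x t) \<le> max vstar (V (x t0) - c * (t - t0))"
    using IH by (auto simp: algebra_simps)
qed simp

lemma norm_le_of_V_le:
  assumes "V y \<le> v"
  shows "norm y \<le> inv_into {0..} \<alpha>l_q v"
  by (rule class_K_inf_le_inv[OF K_inf(6)]) (use assms V_bounds(1)[of y] in auto)

lemma traj_bounded:
  assumes "traj T x"
  shows "\<exists>X. \<forall>t. t0 \<le> t \<and> ereal t < T \<longrightarrow> norm (x t) \<le> X"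
proof (intro exI allI impI)
  fix t assume t: "t0 \<le> t \<and> ereal t < T"
  have "0 \<le> c * (t - t0)" using c_pos t by simp
  then have "V (x t) \<le> max vstar (V (x t0))" using traj_decay[OF assms, of t] t by auto
  then show "norm (x t) \<le> inv_into {0..} \<alpha>l_q (max vstar (V (x t0)))" by (rule norm_le_of_V_le)
qed

lemma event_dwell_time:
  "\<exists>\<delta>>0. \<forall>x s t. s \<le> t \<and> continuous_on {s..t} x \<and> (\<forall>\<tau>\<in>{s..t}. norm (x \<tau>) \<le> X) \<and> event x s t
    \<longrightarrow> s + \<delta> \<le> t"
proof -
  have "compact (g ` cball 0 X)"
    by (intro compact_continuous_image continuous_on_subset[OF g_continuous]) auto
  then obtain G where "\<forall>y\<in>cball 0 X. norm (g y) \<le> G"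
    by (auto dest!: compact_imp_bounded simp: bounded_iff)
  then have G: "norm (g y) \<le> G" if "norm y \<le> X" for y using that by simp
  obtain \<delta> where \<delta>: "\<delta> > 0" "\<And>w s t. s \<le> t \<Longrightarrow> continuous_on {s..t} w \<Longrightarrow>
      (\<forall>\<tau>\<in>{s..t}. norm (w \<tau>) \<le> 2 * G) \<Longrightarrow> event_condition \<gamma> U w s t \<Longrightarrow> s + \<delta> \<le> t"
    using event_condition_dwell_time[OF \<gamma> K_inf(1) \<gamma>_bigo U_continuous U_bounds(1), of "2 * G"] by blast
  have "s + \<delta> \<le> t" if st: "s \<le> t" and xc: "continuous_on {s..t} x"
    and X: "\<forall>\<tau>\<in>{s..t}. norm (x \<tau>) \<le> X" and ev: "event x s t" for x s t
  proof (rule \<delta>(2)[OF st continuous_on_sampling_error[OF xc] _ ev])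
    show "\<forall>\<tau>\<in>{s..t}. norm (sampling_error g x s \<tau>) \<le> 2 * G"
    proof
      fix \<tau> assume "\<tau> \<in> {s..t}"
      then have "norm (g (x s)) \<le> G" "norm (g (x \<tau>)) \<le> G" using X st G by auto
      then show "norm (sampling_error g x s \<tau>) \<le> 2 * G"
        using norm_triangle_ineq4[of "g (x s)" "g (x \<tau>)"] by (simp add: sampling_error_def)
    qed
  qed
  then show ?thesis using \<delta>(1) by blast
qed

text \<open>One dwell time serves all sampling intervals, since \<open>traj_bounded\<close> bounds
  the state on all of \<open>[t0, T)\<close> at once.\<close>

lemma inst_lower_bound:
  assumes "traj T x"
  shows "\<exists>\<delta>>0. \<forall>k. ereal (t0 + real k * \<delta>) \<le> inst T x k"
proof -
  obtain X where X: "\<And>t. t0 \<le> t \<Longrightarrow> ereal t < T \<Longrightarrow> norm (x t) \<le> X"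
    using traj_bounded[OF assms] by blast
  obtain \<delta> where \<delta>: "\<delta> > 0" "\<And>x s t. s \<le> t \<Longrightarrow> continuous_on {s..t} x \<Longrightarrow>
      (\<forall>\<tau>\<in>{s..t}. norm (x \<tau>) \<le> X) \<Longrightarrow> event x s t \<Longrightarrow> s + \<delta> \<le> t"
    using event_dwell_time[of X] by blast
  have "ereal (t0 + real k * \<delta>) \<le> inst T x k" for k
  proof (induction k)
    case (Suc k)
    show ?case
    proof (cases rule: inst_cases[of T x k])
      case 1
      then have "inst T x (Suc k) = \<infinity>" by (rule inst_Suc_infinity)
      then show ?thesis by simp
    next
      case (2 s)
      show ?thesis
      proof (rule inst_Suc_geI[OF 2(2)])
        fix t assume t: "s \<le> t" "ereal t < T" "event x s t"
        have "continuous_on {s..t} x"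
          by (rule continuous_on_subset[OF traj_continuous_on[OF assms t(2)]]) (use 2 in auto)
        moreover have "norm (x \<tau>) \<le> X" if "\<tau> \<in> {s..t}" for \<tau>
        proof -
          have "ereal \<tau> \<le> ereal t" using that by simp
          then have "ereal \<tau> < T" using t(2) by (rule le_less_trans)
          then show ?thesis using X that 2 by simp
        qed
        ultimately have "s + \<delta> \<le> t" using \<delta>(2)[OF t(1)] t(3) by blast
        moreover have "t0 + real k * \<delta> \<le> s" using Suc 2 by simp
        ultimately show "ereal (t0 + real (Suc k) * \<delta>) \<le> ereal t" by (simp add: algebra_simps)
      qed
    qed
  qed simp
  then show ?thesis using \<delta>(1) by blast
qed

lemma traj_zeno_free:
  assumes "traj T x"
  shows "zeno_free (inst T x)"
  unfolding zeno_free_def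
proof
  fix t :: real
  obtain \<delta> where \<delta>: "\<delta> > 0" "\<And>k. ereal (t0 + real k * \<delta>) \<le> inst T x k"
    using inst_lower_bound[OF assms] by blast
  have "{k. inst T x k \<le> ereal t} \<subseteq> {..nat \<lceil>(t - t0) / \<delta>\<rceil>}"
  proof clarify
    fix k assume "inst T x k \<le> ereal t"
    with \<delta>(2)[of k] have "ereal (t0 + real k * \<delta>) \<le> ereal t" by (rule order.trans)
    then have "real k \<le> (t - t0) / \<delta>" using \<delta>(1) by (simp add: field_simps)
    then show "k \<le> nat \<lceil>(t - t0) / \<delta>\<rceil>" by linarith
  qed
  then show "finite {k. inst T x k \<le> ereal t}" by (rule finite_subset) simp
qed

subsection \<open>Existence and prolongation\<close>

text \<open>For curves with finitely many events: an infinite instant makes the supremum clause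
  trivial.\<close>

lemma trajI:
  assumes "ereal t0 < T" "inst T x n = \<infinity>"
    and "\<And>k s b. inst T x k = ereal s \<Longrightarrow> s \<le> b \<Longrightarrow> ereal b \<le> inst T x (Suc k) \<Longrightarrow> ereal b < T \<Longrightarrow>
      sol (g (x s)) x s b"
  shows "traj T x"
  unfolding closed_loop_trajectory_def
proof (intro conjI allI impI)
  have "inst T x n \<le> (SUP k. inst T x k)" by (rule SUP_upper) simp
  then show "T \<le> (SUP k. inst T x k)" using assms(2) by simp
  fix k a b
  assume h: "inst T x k \<le> ereal a \<and> a \<le> b \<and> ereal b \<le> inst T x (Suc k) \<and> ereal b < T"
  then obtain s where s: "inst T x k = ereal s" by (cases rule: inst_cases[of T x k]) auto
  then have "sol (g (x s)) x s b" using h by (intro assms(3)) auto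
  then show "((\<lambda>\<tau>. f (x \<tau>, g (x (real_of_ereal (inst T x k))), d \<tau>)) has_integral (x b - x a)) {a..b}"
    using caratheodory_solutionD[of "\<lambda>\<tau> y. f (y, g (x s), d \<tau>)" x s b a b] s h by simp
qed (rule assms(1))

lemma inst_less_Suc:
  assumes xc: "continuous_on {s..e} x" "s < e" and s: "inst (ereal e) x k = ereal s"
  shows "ereal s < inst (ereal e) x (Suc k)"
proof -
  have "compact (x ` {s..e})" by (intro compact_continuous_image xc) auto
  then obtain X where "\<forall>t\<in>{s..e}. norm (x t) \<le> X"
    by (auto dest!: compact_imp_bounded simp: bounded_iff)
  then have X: "norm (x t) \<le> X" if "s \<le> t" "t \<le> e" for t using that by simp
  obtain \<delta> where \<delta>: "\<delta> > 0" "\<And>x s t. s \<le> t \<Longrightarrow> continuous_on {s..t} x \<Longrightarrow>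
      (\<forall>\<tau>\<in>{s..t}. norm (x \<tau>) \<le> X) \<Longrightarrow> event x s t \<Longrightarrow> s + \<delta> \<le> t"
    using event_dwell_time[of X] by blast
  have "ereal (s + \<delta>) \<le> inst (ereal e) x (Suc k)"
  proof (rule inst_Suc_geI[OF s])
    fix t assume t: "s \<le> t" "ereal t < ereal e" "event x s t"
    have "continuous_on {s..t} x" by (rule continuous_on_subset[OF xc(1)]) (use t in auto)
    then show "ereal (s + \<delta>) \<le> ereal t" using \<delta>(2)[OF t(1) _ _ t(3)] X t by auto
  qed
  moreover have "ereal s < ereal (s + \<delta>)" using \<delta> by simp
  ultimately show ?thesis by (rule less_le_trans[rotated])
qed

lemma traj_exists: "\<exists>T x. traj T x \<and> x t0 = x0"
proof -
  obtain \<delta> y where \<delta>: "\<delta> > 0" and y: "y t0 = x0" "sol (g x0) y t0 (t0 + \<delta>)"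
    using local_existence[OF f D d_measurable d(1) order_refl, of x0 "g x0"] by blast
  define E where "E = ereal (t0 + \<delta>)"
  \<comment> \<open>The horizon is cut at the first event, so only one sampling interval has to be
    checked.\<close>
  define T where "T = min E (inst E y (Suc 0))"
  have "ereal t0 < inst E y (Suc 0)"
    unfolding E_def using \<delta> caratheodory_solution_continuous_on[OF y(2)]
    by (intro inst_less_Suc) auto
  then have t0T: "ereal t0 < T" using \<delta> by (simp add: T_def E_def)
  have restr: "inst T y k = (if inst E y k < T then inst E y k else \<infinity>)" for k
    by (rule inst_restrict[OF _ t0T]) (simp_all add: T_def)
  have inf: "inst T y (Suc 0) = \<infinity>" unfolding restr by (simp add: T_def)
  have "traj T y"
  proof (rule trajI[OF t0T inf])
    fix k s b assume k: "inst T y k = ereal s" "s \<le> b" "ereal b < T"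
    have "k = 0"
    proof (rule ccontr)
      assume "k \<noteq> 0"
      then have "inst T y (Suc 0) \<le> inst T y k" by (intro inst_mono) simp
      then show False using inf k by simp
    qed
    then have "s = t0" using k by simp
    moreover have "b \<le> t0 + \<delta>" using k(3) by (simp add: T_def E_def)
    ultimately show "sol (g (y s)) y s b"
      using caratheodory_solution_subinterval[OF y(2) order_refl] y(1) by simp
  qed
  then show ?thesis using y by blast
qed

text \<open>At the end point \<open>e\<close> of a trajectory the input is renewed exactly if the event condition holds
  there. The infimum in the sampling law can also equal \<open>e\<close> without being attained, through
  events occurring immediately after \<open>e\<close>; then the error vanishes on \<open>[s, e]\<close> and the two inputs agree.\<close>

lemma traj_prolongation:
  assumes tr: "traj (ereal e) x"
  shows "\<exists>T x'. traj T x' \<and> ereal e < T \<and> (\<forall>t. t0 \<le> t \<and> t < e \<longrightarrow> x' t = x t)"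
proof -
  have t0e: "t0 < e" using tr by (simp add: closed_loop_trajectory_def)
  \<comment> \<open>The dwell time pushes the instants past \<open>e\<close>, and an instant after
    the initial one that is not below the horizon is \<open>\<infinity>\<close>.\<close>
  have "\<exists>k. inst (ereal e) x k = \<infinity>"
  proof -
    obtain \<delta> where \<delta>: "\<delta> > 0" "\<And>k. ereal (t0 + real k * \<delta>) \<le> inst (ereal e) x k"
      using inst_lower_bound[OF tr] by blast
    obtain k where "(e - t0) / \<delta> < real k" using reals_Archimedean2 by blast
    then have k: "e < t0 + real k * \<delta>" using \<delta>(1) by (simp add: field_simps)
    then have "k \<noteq> 0" using t0e by (cases k) auto
    then obtain j where j: "k = Suc j" by (cases k) auto
    have "ereal e < inst (ereal e) x k" using \<delta>(2)[of k] k
      by (meson less_ereal.simps(1) less_le_trans)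
    then show ?thesis using inst_Suc_less_or_infinity[of "ereal e" x j] j by (metis less_asym)
  qed
  then obtain n where n: "inst (ereal e) x n = \<infinity>" "\<And>k. k < n \<Longrightarrow> inst (ereal e) x k \<noteq> \<infinity>"
    using exists_least_iff[of "\<lambda>k. inst (ereal e) x k = \<infinity>"] by blast
  have "n \<noteq> 0" using n(1) by (cases n) auto
  then obtain K where K: "n = Suc K" by (cases n) auto
  have finK: "inst (ereal e) x k < ereal e" if "k \<le> K" for k
    using that n(2)[of k] K t0e inst_Suc_less_or_infinity[of "ereal e" x] by (cases k) force+
  obtain s where s: "t0 \<le> s" "inst (ereal e) x K = ereal s"
    using finK[of K] by (cases rule: inst_cases[of "ereal e" x K]) auto
  have se: "s < e" using finK[of K] s by simp
  have sol_x: "sol (g (x s)) x s b" if "b < e" for b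
    by (rule traj_sol[OF tr s(2)]) (use n(1) K that in auto)
  have noev_x: "\<not> event x s r" if "s \<le> r" "r < e" for r
    using inst_Suc_le[OF s(2) that(1)] that n(1) K by fastforce
  obtain X where X: "\<And>t. t0 \<le> t \<Longrightarrow> t < e \<Longrightarrow> norm (x t) \<le> X"
    using traj_bounded[OF tr] by auto
  have xc: "continuous_on {s..<e} x"
    unfolding continuous_on_eq_continuous_within
  proof
    fix t assume t: "t \<in> {s..<e}"
    define b where "b = (t + e) / 2"
    have b: "t < b" "b < e" using t by (auto simp: b_def)
    have "continuous_on {s..b} x" by (rule caratheodory_solution_continuous_on[OF sol_x[OF b(2)]])
    then have "continuous (at t within {s..b}) x" using t b by (auto simp: continuous_on_eq_continuous_within)
    moreover have "at t within {s..b} = at t within {s..<e}"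
      by (rule at_within_nhd[of t "{..<b}"]) (use t b in auto)
    ultimately show "continuous (at t within {s..<e}) x" by simp
  qed
  define \<phi> where "\<phi> \<tau> = f (x \<tau>, g (x s), d \<tau>)" for \<tau>
  define xe where "xe = x s + integral {s..e} \<phi>"
  \<comment> \<open>A trajectory on \<open>[t0, e)\<close> does not constrain \<open>x e\<close>;
    the value there is replaced by the one that the integral dictates.\<close>
  define z where "z = x(e := xe)"
  have zc: "continuous_on {s..<e} z"
    using xc by (rule continuous_on_eq) (auto simp: z_def)
  have z_int: "(\<lambda>\<tau>. f (z \<tau>, g (x s), d \<tau>)) integrable_on {s..e}"
    by (rule integrable_along_curve[OF f_continuous D d_measurable d(1) s(1) zc, where X = X])
      (use X s in \<open>auto simp: z_def\<close>)
  have sol_z: "sol (g (x s)) z s e"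
  proof (rule caratheodory_solution_integral)
    show "(\<lambda>\<tau>. f (z \<tau>, g (x s), d \<tau>)) integrable_on {s..e}" by (rule z_int)
    fix t assume t: "s \<le> t" "t \<le> e"
    have eq: "integral {s..t} (\<lambda>\<tau>. f (z \<tau>, g (x s), d \<tau>)) = integral {s..t} \<phi>"
      by (rule integral_spike[of "{e}"]) (auto simp: z_def \<phi>_def)
    show "z t = x s + integral {s..t} (\<lambda>\<tau>. f (z \<tau>, g (x s), d \<tau>))"
    proof (cases "t = e")
      case True
      then show ?thesis using eq by (simp add: z_def xe_def)
    next
      case False
      have "(\<phi> has_integral (x t - x s)) {s..t}"
        unfolding \<phi>_def using caratheodory_solutionD[OF sol_x, of t s t] t False by simp
      then show ?thesis using eq False by (simp add: z_def integral_unique)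
    qed
  qed
  define u where "u = (if event z s e then g xe else g (x s))"
  obtain \<delta> y where \<delta>: "\<delta> > 0" and y: "y e = xe" "sol u y e (e + \<delta>)"
    using local_existence[OF f D d_measurable d(1), of e xe u] t0e by auto
  define x' where "x' t = (if t < e then x t else y t)" for t
  define E where "E = ereal (e + \<delta>)"
  have x'_x: "x' t = x t" if "t < e" for t using that by (simp add: x'_def)
  have x'e: "x' e = xe" by (simp add: x'_def y)
  have sol_l: "sol (g (x s)) x' s e"
    by (rule caratheodory_solution_cong[OF sol_z]) (auto simp: z_def x'_def y)
  have sol_r: "sol u x' e (e + \<delta>)"
    by (rule caratheodory_solution_cong[OF y(2)]) (auto simp: x'_def)
  have x'c: "continuous_on {s..e + \<delta>} x'"
  proof -
    have "continuous_on ({s..e} \<union> {e..e + \<delta>}) x'"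
      by (intro continuous_on_closed_Un caratheodory_solution_continuous_on[OF sol_l]
          caratheodory_solution_continuous_on[OF sol_r]) auto
    moreover have "{s..e} \<union> {e..e + \<delta>} = {s..e + \<delta>}" using se \<delta> by auto
    ultimately show ?thesis by simp
  qed
  have ev: "event x' s e \<longleftrightarrow> event z s e"
    by (rule event_cong) (use se in \<open>auto simp: z_def x'_def y\<close>)
  have noev_x': "\<not> event x' s r" if "s \<le> r" "r < e" for r
    using noev_x[OF that] event_cong[of s r x' x] that x'_x by auto
  have restr: "inst (ereal e) x k = (if inst E x' k < ereal e then inst E x' k else \<infinity>)" for k
    by (rule inst_restrict) (use \<delta> t0e x'_x in \<open>auto simp: E_def\<close>)
  have inst_eq: "inst E x' k = inst (ereal e) x k" if "k \<le> K" for k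
    using restr[of k] finK[OF that] by (auto split: if_splits)
  define N where "N = inst E x' (Suc K)"
  have eN: "ereal e \<le> N" using restr[of "Suc K"] n(1) K by (auto simp: N_def split: if_splits)
  have sE: "inst E x' K = ereal s" using inst_eq[of K] s by simp
  have u_late: "u = g (x s)" if "ereal e < N"
  proof -
    have "\<not> event x' s e"
      using inst_Suc_le[OF sE, of e] that se \<delta> by (auto simp: N_def E_def)
    then show ?thesis using ev by (simp add: u_def)
  qed
  \<comment> \<open>If the input were not renewed in effect, the error at \<open>e\<close> would be
    nonzero without an event, and no event could follow immediately; the infimum would exceed
    \<open>e\<close>.\<close>
  have u_now: "u = g xe" if "N = ereal e"
  proof (rule ccontr)
    assume not: "u \<noteq> g xe"
    then have noev: "\<not> event x' s e" and u: "g xe \<noteq> g (x s)" using ev by (auto simp: u_def split: if_splits)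
    have wc: "continuous_on {s..e + \<delta>} (sampling_error g x' s)" using x'c by (rule continuous_on_sampling_error)
    have wc': "continuous_on {s..e} (sampling_error g x' s)"
      by (rule continuous_on_subset[OF wc]) (use \<delta> in auto)
    have "0 < norm (sampling_error g x' s e)"
      using u se x'_x by (simp add: sampling_error_def x'e)
    also have "\<dots> \<le> sup_norm_on (sampling_error g x' s) s e"
      by (rule norm_le_sup_norm_on[OF wc']) (use se in auto)
    finally have "sup_norm_on (sampling_error g x' s) s e \<noteq> 0" by simp
    from no_event_right[OF \<gamma> U_continuous wc _ _ noev this] obtain \<epsilon> where \<epsilon>: "\<epsilon> > 0"
      "\<And>r. e \<le> r \<Longrightarrow> r < e + \<epsilon> \<Longrightarrow> \<not> event x' s r" using se \<delta> by auto
    have "ereal (e + \<epsilon>) \<le> N"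
      unfolding N_def
    proof (rule inst_Suc_geI[OF sE])
      fix t assume t: "s \<le> t" "event x' s t"
      show "ereal (e + \<epsilon>) \<le> ereal t" using noev_x'[of t] \<epsilon>(2)[of t] t by (cases "t < e") force+
    qed
    then show False using that \<epsilon>(1) by simp
  qed
  \<comment> \<open>Cut before any further event: past \<open>e\<close> the curve uses the single
    input \<open>u\<close>, in a new sampling interval if \<open>N\<close> is \<open>e\<close> and
    in the old one otherwise.\<close>
  define T where "T = min E (if N = ereal e then inst E x' (Suc (Suc K)) else N)"
  have eT: "ereal e < T"
  proof (cases "N = ereal e")
    case True
    have "ereal e < inst E x' (Suc (Suc K))"
      unfolding E_def
    proof (rule inst_less_Suc)
      show "continuous_on {e..e + \<delta>} x'" by (rule continuous_on_subset[OF x'c]) (use se in auto)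
    qed (use True \<delta> in \<open>auto simp: N_def E_def\<close>)
    then show ?thesis using True \<delta> by (simp add: T_def E_def)
  next
    case False
    then show ?thesis using eN \<delta> by (simp add: T_def E_def)
  qed
  have t0T: "ereal t0 < T" using eT t0e by (meson less_ereal.simps(1) less_trans)
  have restr': "inst T x' k = (if inst E x' k < T then inst E x' k else \<infinity>)" for k
    by (rule inst_restrict[OF _ t0T]) (simp_all add: T_def)
  have late: "T \<le> inst E x' (Suc (Suc K))"
  proof (cases "N = ereal e")
    case False
    then have "T \<le> N" by (simp add: T_def)
    also have "N \<le> inst E x' (Suc (Suc K))" unfolding N_def by (rule inst_le_Suc)
    finally show ?thesis .
  qed (simp add: T_def)
  have inf: "inst T x' (Suc (Suc K)) = \<infinity>" using restr'[of "Suc (Suc K)"] late by (simp add: not_less[symmetric])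
  have "traj T x'"
  proof (rule trajI[OF t0T inf])
    fix k r b assume k: "inst T x' k = ereal r" "r \<le> b" "ereal b \<le> inst T x' (Suc k)" "ereal b < T"
    have r: "inst E x' k = ereal r" "ereal r < T" using restr'[of k] k(1) by (auto split: if_splits)
    have b: "ereal b \<le> inst E x' (Suc k)" using restr'[of "Suc k"] k(3,4) by (auto split: if_splits)
    have bE: "b \<le> e + \<delta>" using k(4) by (simp add: T_def E_def)
    have "k \<le> Suc K"
    proof (rule ccontr)
      assume "\<not> ?thesis"
      then have "inst T x' (Suc (Suc K)) \<le> inst T x' k" by (intro inst_mono) simp
      then show False using inf k(1) by simp
    qed
    \<comment> \<open>Intervals completed before \<open>e\<close>; the last old interval, possibly
      continued past \<open>e\<close>; and the new interval, present only when \<open>N\<close> is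
      \<open>e\<close>.\<close>
    then consider "k < K" | "k = K" | "k = Suc K" by linarith
    then show "sol (g (x' r)) x' r b"
    proof cases
      case 1
      have "inst E x' (Suc k) = inst (ereal e) x (Suc k)" using 1 by (intro inst_eq) simp
      then have b': "ereal b \<le> inst (ereal e) x (Suc k)" using b by simp
      also have "\<dots> < ereal e" using 1 by (intro finK) simp
      finally have "b < e" by simp
      moreover have "inst (ereal e) x k = ereal r" using inst_eq[of k] r(1) 1 by simp
      ultimately have "sol (g (x r)) x r b" using b' by (intro traj_sol[OF tr]) auto
      then have "sol (g (x r)) x' r b"
        by (rule caratheodory_solution_cong) (use \<open>b < e\<close> in \<open>auto intro: x'_x\<close>)
      moreover have "x' r = x r" using k(2) \<open>b < e\<close> by (intro x'_x) simp
      ultimately show ?thesis by simp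
    next
      case 2
      then have rs: "r = s" using sE r(1) by simp
      show ?thesis
      proof (cases "N = ereal e")
        case True
        then have "b \<le> e" using b 2 by (simp add: N_def)
        then show ?thesis
          using caratheodory_solution_subinterval[OF sol_l order_refl] rs se x'_x by simp
      next
        case False
        then have "u = g (x s)" using eN by (intro u_late) simp
        then have "sol (g (x s)) x' s (e + \<delta>)"
          using caratheodory_solution_combine[OF sol_l] sol_r by simp
        then show ?thesis
          using caratheodory_solution_subinterval[OF _ order_refl bE] rs se x'_x by simp
      qed
    next
      case 3
      then have "N < T" using r by (simp add: N_def)
      then have Ne: "N = ereal e" by (auto simp: T_def split: if_splits)
      then have "r = e" using r(1) 3 by (simp add: N_def)
      then show ?thesis
        using caratheodory_solution_subinterval[OF sol_r order_refl bE] u_now[OF Ne] x'e by simp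
    qed
  qed
  then show ?thesis using eT x'_x by blast
qed

section \<open>Gluing of trajectories and maximal extension\<close>

lemma traj_Union:
  assumes ne: "I \<noteq> {}" and tr: "\<And>i. i \<in> I \<Longrightarrow> traj (T i) (x i)"
    and agree: "\<And>i j t. i \<in> I \<Longrightarrow> j \<in> I \<Longrightarrow> t0 \<le> t \<Longrightarrow> ereal t < T i \<Longrightarrow> ereal t < T j \<Longrightarrow> x i t = x j t"
  shows "\<exists>y. traj (SUP i\<in>I. T i) y \<and> (\<forall>i\<in>I. \<forall>t. t0 \<le> t \<and> ereal t < T i \<longrightarrow> y t = x i t)"
proof -
  define S where "S = (SUP i\<in>I. T i)"
  \<comment> \<open>Agreement on common domains makes the value independent of the chosen
    index.\<close>
  define y where "y t = x (SOME i. i \<in> I \<and> ereal t < T i) t" for t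
  have y: "y t = x i t" if "i \<in> I" "t0 \<le> t" "ereal t < T i" for i t
  proof -
    have "(SOME i. i \<in> I \<and> ereal t < T i) \<in> I \<and> ereal t < T (SOME i. i \<in> I \<and> ereal t < T i)"
      by (rule someI[of _ i]) (use that in auto)
    then show ?thesis unfolding y_def using agree that by blast
  qed
  have TS: "T i \<le> S" if "i \<in> I" for i unfolding S_def using that by (rule SUP_upper)
  have t0T: "ereal t0 < T i" if "i \<in> I" for i using tr[OF that] by (simp add: closed_loop_trajectory_def)
  have restr: "inst (T i) (x i) k = (if inst S y k < T i then inst S y k else \<infinity>)" if "i \<in> I" for i k
    by (rule inst_restrict[OF TS[OF that] t0T[OF that]]) (use y that in auto)
  have "traj S y"
    unfolding closed_loop_trajectory_def
  proof (intro conjI allI impI)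
    show "ereal t0 < S" using ne t0T TS less_le_trans by blast
    show "S \<le> (SUP k. inst S y k)"
    \<comment> \<open>The supremum \<open>S\<close> need not be any of the \<open>T i\<close>, so
      instants are found only above each \<open>r < S\<close>.\<close>
    proof (rule dense_le)
      fix r assume "r < S"
      then obtain i where i: "i \<in> I" "r < T i" unfolding S_def by (auto simp: less_SUP_iff)
      then have "r < (SUP k. inst (T i) (x i) k)"
        using tr[OF i(1)] unfolding closed_loop_trajectory_def by (blast intro: less_le_trans)
      then obtain k where "r < inst (T i) (x i) k" by (auto simp: less_SUP_iff)
      then have "r < inst S y k" using restr[OF i(1), of k] i(2) by (auto split: if_splits)
      also have "\<dots> \<le> (SUP k. inst S y k)" by (rule SUP_upper) simp
      finally show "r \<le> (SUP k. inst S y k)" by simp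
    qed
    fix k a b
    assume h: "inst S y k \<le> ereal a \<and> a \<le> b \<and> ereal b \<le> inst S y (Suc k) \<and> ereal b < S"
    then obtain i where i: "i \<in> I" "ereal b < T i" unfolding S_def by (auto simp: less_SUP_iff)
    obtain s where s: "t0 \<le> s" "inst S y k = ereal s" using h by (cases rule: inst_cases[of S y k]) auto
    then have sb: "s \<le> b" using h by simp
    then have "ereal s < T i" using i(2) by (meson ereal_less_eq(3) le_less_trans)
    then have ik: "inst (T i) (x i) k = ereal s" using restr[OF i(1), of k] s by simp
    have "ereal b \<le> inst (T i) (x i) (Suc k)" using restr[OF i(1), of "Suc k"] h by auto
    then have sol: "sol (g (x i s)) (x i) s b" by (rule traj_sol[OF tr[OF i(1)] ik _ i(2)])
    have y_eq: "y t = x i t" if "s \<le> t" "t \<le> b" for t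
    proof (rule y[OF i(1)])
      show "ereal t < T i" using that(2) i(2) by (meson ereal_less_eq(3) le_less_trans)
    qed (use that s in auto)
    then have "sol (g (y s)) y s b" using caratheodory_solution_cong[OF sol] sb by simp
    then show "((\<lambda>\<tau>. f (y \<tau>, g (y (real_of_ereal (inst S y k))), d \<tau>)) has_integral (y b - y a)) {a..b}"
      using caratheodory_solutionD[of "\<lambda>\<tau> z. f (z, g (y s), d \<tau>)" y s b a b] s h by simp
  qed
  then show ?thesis using y unfolding S_def by blast
qed

text \<open>Zorn's lemma on graphs over \<open>[t0, T)\<close>: inclusion of graphs is prolongation,
  and the values of the curve from \<open>T\<close> on are forgotten. Chains are bounded by
  gluing.\<close>

lemma maximal_trajectory_exists: "\<exists>T x. maximal_trajectory f g \<gamma> U d t0 T x \<and> x t0 = x0"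
proof -
  define graph :: "ereal \<times> (real \<Rightarrow> real^'n) \<Rightarrow> (real \<times> (real^'n)) set"
    where "graph p = {(t, snd p t) |t. t0 \<le> t \<and> ereal t < fst p}" for p
  define P where "P = {p. traj (fst p) (snd p) \<and> snd p t0 = x0}"
  have "\<exists>M\<in>graph ` P. \<forall>X\<in>graph ` P. M \<subseteq> X \<longrightarrow> X = M"
  proof (rule subset_Zorn_nonempty)
    show "graph ` P \<noteq> {}" using traj_exists[of x0] by (auto simp: P_def)
    fix C assume C: "C \<noteq> {}" "subset.chain (graph ` P) C"
    define I where "I = {p \<in> P. graph p \<in> C}"
    have CI: "C = graph ` I" using C(2) by (auto simp: I_def subset.chain_def)
    have agree: "snd p t = snd q t"
      if pq: "p \<in> I" "q \<in> I" and t: "t0 \<le> t" "ereal t < fst p" "ereal t < fst q" for p q t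
    proof -
      have "graph p \<subseteq> graph q \<or> graph q \<subseteq> graph p"
        using C(2) pq unfolding I_def subset_chain_def by blast
      moreover have "(t, snd p t) \<in> graph p" "(t, snd q t) \<in> graph q" using t by (auto simp: graph_def)
      ultimately show ?thesis by (auto simp: graph_def)
    qed
    have "\<exists>y. traj (SUP p\<in>I. fst p) y \<and> (\<forall>p\<in>I. \<forall>t. t0 \<le> t \<and> ereal t < fst p \<longrightarrow> y t = snd p t)"
    proof (rule traj_Union[where T = fst and x = snd])
      show "I \<noteq> {}" using C(1) CI by auto
      show "traj (fst p) (snd p)" if "p \<in> I" for p using that by (simp add: I_def P_def)
    qed (rule agree)
    then obtain y where y: "traj (SUP p\<in>I. fst p) y"
      "\<And>p t. p \<in> I \<Longrightarrow> t0 \<le> t \<Longrightarrow> ereal t < fst p \<Longrightarrow> y t = snd p t" by blast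
    obtain p where p: "p \<in> I" using C(1) CI by auto
    have "ereal t0 < fst p" "snd p t0 = x0"
      using p by (auto simp: I_def P_def closed_loop_trajectory_def)
    then have "y t0 = x0" using y(2)[OF p, of t0] by simp
    then have "(SUP p\<in>I. fst p, y) \<in> P" using y(1) by (simp add: P_def)
    moreover have "graph (SUP p\<in>I. fst p, y) = \<Union>C"
      unfolding CI using y(2) by (auto simp: graph_def less_SUP_iff)
    ultimately show "\<Union>C \<in> graph ` P" by (metis image_eqI)
  qed
  then obtain p where p: "p \<in> P" "\<And>q. q \<in> P \<Longrightarrow> graph p \<subseteq> graph q \<Longrightarrow> graph q = graph p" by auto
  have t0p: "ereal t0 < fst p" using p(1) by (simp add: P_def closed_loop_trajectory_def)
  have "maximal_trajectory f g \<gamma> U d t0 (fst p) (snd p)"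
    unfolding maximal_trajectory_def
  proof (intro conjI allI impI)
    show "traj (fst p) (snd p)" using p(1) by (simp add: P_def)
    fix T' x' assume h: "traj T' x' \<and> fst p \<le> T' \<and> (\<forall>t. t0 \<le> t \<and> ereal t < fst p \<longrightarrow> x' t = snd p t)"
    have "x' t0 = x0" using h t0p p(1) by (auto simp: P_def)
    then have q: "(T', x') \<in> P" using h by (simp add: P_def)
    have "graph p \<subseteq> graph (T', x')"
    proof
      fix v assume "v \<in> graph p"
      then obtain t where t: "v = (t, snd p t)" "t0 \<le> t" "ereal t < fst p" by (auto simp: graph_def)
      then have "x' t = snd p t" "ereal t < T'" using h by (auto intro: less_le_trans)
      then show "v \<in> graph (T', x')" using t by (auto simp: graph_def)
    qed
    then have eq: "graph (T', x') = graph p" using p(2) q by blast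
    \<comment> \<open>The graph determines the horizon: a real time strictly between the two
      horizons would lie in only one of the domains.\<close>
    show "T' = fst p"
    proof (rule ccontr)
      assume "T' \<noteq> fst p"
      then have "fst p < T'" using h by (auto simp: less_le)
      then obtain r where r: "fst p < ereal r" "ereal r < T'" using ereal_dense2 by blast
      have "ereal t0 < ereal r" using t0p r(1) by (rule less_trans)
      then have "(r, x' r) \<in> graph (T', x')" using r by (auto simp: graph_def)
      then have "(r, x' r) \<in> graph p" unfolding eq .
      then show False using r(1) by (auto simp: graph_def)
    qed
  qed
  then show ?thesis using p(1) by (auto simp: P_def)
qed

lemma maximal_trajectory_infinite:
  assumes "maximal_trajectory f g \<gamma> U d t0 T x"
  shows "T = \<infinity>"
proof (cases T)
  case (real e)
  then have "traj (ereal e) x" using assms by (simp add: maximal_trajectory_def)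
  from traj_prolongation[OF this] obtain T' x' where T': "traj T' x'" "ereal e < T'"
    "\<forall>t. t0 \<le> t \<and> t < e \<longrightarrow> x' t = x t" by blast
  moreover have "T \<le> T'" using T'(2) real by simp
  ultimately have "T' = T" using assms real unfolding maximal_trajectory_def by auto
  then show ?thesis using T'(2) real by simp
next
  case MInf
  then show ?thesis using assms by (simp add: maximal_trajectory_def closed_loop_trajectory_def)
qed

text \<open>By the time \<open>V (x t0) / c\<close> has elapsed, the decreasing term is at most 0,
  hence below \<open>vstar\<close>. This delay involves the disturbance only through
  \<open>dbar\<close>.\<close>

lemma maximal_trajectory_ultimate_bound:
  assumes "maximal_trajectory f g \<gamma> U d t0 T x" and t: "t0 + V (x t0) / c \<le> t"
  shows "norm (x t) \<le> inv_into {0..} \<alpha>l_q vstar"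
proof -
  have tr: "traj T x" using assms by (simp add: maximal_trajectory_def)
  have "0 \<le> V (x t0) / c" using V_bounds(3) c_pos by simp
  then have "t0 \<le> t" using t by simp
  then have "V (x t) \<le> max vstar (V (x t0) - c * (t - t0))"
    using traj_decay[OF tr, of t] maximal_trajectory_infinite[OF assms(1)] by simp
  moreover have "V (x t0) - c * (t - t0) \<le> 0" using t c_pos by (simp add: field_simps)
  moreover have "0 \<le> vstar"
    unfolding vstar_def using c_pos
    by (intro class_K_inf_nonneg[OF K_inf(7)] class_K_inf_inv(1)[OF K_inf(8)]) simp
  ultimately have "V (x t) \<le> vstar" by linarith
  then show ?thesis by (rule norm_le_of_V_le)
qed

end

theorem mainTheorem3:
  fixes f :: "(real^'n) \<times> (real^'m) \<times> (real^'d) \<Rightarrow> real^'n"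
    and h :: "real^'n \<Rightarrow> real^'q" and \<kappa> :: "real^'q \<Rightarrow> real^'m"
    and D :: "(real^'d) set" and t0 :: real
    and V Vq :: "real^'n \<Rightarrow> real" and U :: "real^'m \<Rightarrow> real"
    and \<alpha>l \<alpha>u \<alpha> \<sigma> \<zeta> \<alpha>l_w \<alpha>u_w \<alpha>_w \<sigma>_w \<zeta>_w \<alpha>l_q \<alpha>u_q \<alpha>_q \<sigma>_q \<zeta>_q \<alpha>hat_w \<gamma> :: "real \<Rightarrow> real"
  assumes "compact D"
    and "cont_diff f"
    and "h 0 = 0"
    and "cont_diff \<kappa>" and "\<kappa> 0 = 0"
    and "\<forall>x. (\<kappa> \<circ> h) differentiable (at x)"
    and "ISS_Lyapunov (closed_loop_field f (\<kappa> \<circ> h)) D V \<alpha>l \<alpha>u \<alpha> \<sigma> \<zeta>"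
    and "error_growth_bound (error_field f (\<kappa> \<circ> h)) D U \<alpha>l_w \<alpha>u_w \<alpha>_w \<sigma>_w \<zeta>_w"
    and "\<forall>s>0. \<alpha>_q s > 2 * \<sigma>_w s"
    and "\<alpha>_q \<in> O[at_right 0](\<alpha>)"
    and "ISS_Lyapunov (closed_loop_field f (\<kappa> \<circ> h)) D Vq \<alpha>l_q \<alpha>u_q \<alpha>_q \<sigma>_q \<zeta>_q"
    and "class_K_inf \<alpha>hat_w" and "class_K_inf \<gamma>"
    and "\<forall>s>0. \<alpha>hat_w s > \<sigma>_q s / 2"
    and "\<forall>s>0. \<gamma> s > \<alpha>hat_w s + \<alpha>_w s"
    and "\<sigma>_w \<in> O[at_right 0](\<alpha>)"
    and "\<gamma> \<in> O[at_right 0](\<alpha>l_w)"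
  shows "\<exists>\<alpha>l_v \<alpha>u_v \<alpha>_v \<zeta>_v.
    class_K_inf \<alpha>l_v \<and> class_K_inf \<alpha>u_v \<and> class_K_inf \<alpha>_v \<and> class_K_inf \<zeta>_v \<and>
    (\<forall>dbar>0. \<forall>x0. \<exists>\<Delta>t\<ge>0. \<forall>d.
       d \<in> borel_measurable (lebesgue_on {t0..}) \<and> (\<forall>t\<ge>t0. d t \<in> D \<and> norm (d t) \<le> dbar) \<longrightarrow>
       (\<exists>T x. maximal_trajectory f (\<kappa> \<circ> h) \<gamma> U d t0 T x \<and> x t0 = x0) \<and>
       (\<forall>T x. maximal_trajectory f (\<kappa> \<circ> h) \<gamma> U d t0 T x \<and> x t0 = x0 \<longrightarrow>
          T = \<infinity> \<and>
          (\<forall>t\<ge>t0 + \<Delta>t. norm (x t) \<le>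
             (inv_into {0..} \<alpha>l_v \<circ> \<alpha>u_v \<circ> inv_into {0..} \<alpha>_v \<circ> \<zeta>_v) dbar) \<and>
          zeno_free (sampling_instant (\<kappa> \<circ> h) \<gamma> U t0 T x)))"
proof -
  let ?g = "\<kappa> \<circ> h" and ?c = "\<lambda>dbar. \<zeta>_q dbar + \<zeta>_w dbar"
  have K: "class_K_inf \<alpha>l_q" "class_K_inf \<alpha>u_q" "class_K_inf \<alpha>_q" "class_K_inf \<zeta>_q" "class_K_inf \<zeta>_w"
    using assms(8,11) by (auto simp: ISS_Lyapunov_def error_growth_bound_def)
  have loop: "sampled_loop f ?g D t0 dbar d Vq U \<alpha>l_w \<alpha>u_w \<alpha>_w \<sigma>_w \<zeta>_w \<alpha>l_q \<alpha>u_q \<alpha>_q \<sigma>_q \<zeta>_q \<gamma>"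
    if "0 < dbar" "d \<in> borel_measurable (lebesgue_on {t0..})"
      "\<forall>t\<ge>t0. d t \<in> D \<and> norm (d t) \<le> dbar" for dbar d
  proof
    fix s :: real assume s: "0 < s"
    have "\<sigma>_q s / 2 < \<alpha>hat_w s" "\<alpha>hat_w s + \<alpha>_w s < \<gamma> s" using assms(14,15) s by auto
    then show "\<sigma>_q s + 2 * \<alpha>_w s < 2 * \<gamma> s" by simp
  qed (use assms that in auto)
  show ?thesis
  \<comment> \<open>Read off from the definition of \<open>vstar\<close>: the bound is
    \<open>vstar\<close> pulled back through \<open>\<alpha>l_q\<close>. The four functions depend
    on neither \<open>dbar\<close> nor the disturbance, and \<open>10 * c\<close> becomes a
    comparison function of \<open>dbar\<close>.\<close>
  proof (rule exI[of _ \<alpha>l_q], rule exI[of _ \<alpha>u_q], rule exI[of _ \<alpha>_q],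
      rule exI[of _ "\<lambda>s. 10 * ?c s"], intro conjI allI impI)
    show "class_K_inf (\<lambda>s. 10 * ?c s)" by (rule class_K_inf_add_scale) (use K in auto)
    fix dbar :: real and x0 assume dbar: "0 < dbar"
    have "0 < ?c dbar" using class_K_inf_pos[OF K(4) dbar] class_K_inf_pos[OF K(5) dbar] by simp
    moreover have "0 \<le> Vq x0" using assms(11) by (simp add: ISS_Lyapunov_def)
    ultimately have "0 \<le> Vq x0 / ?c dbar" by simp
    moreover have
      "(\<exists>T x. maximal_trajectory f ?g \<gamma> U d t0 T x \<and> x t0 = x0) \<and>
       (\<forall>T x. maximal_trajectory f ?g \<gamma> U d t0 T x \<and> x t0 = x0 \<longrightarrow>
          T = \<infinity> \<and>
          (\<forall>t\<ge>t0 + Vq x0 / ?c dbar. norm (x t) \<le>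
             (inv_into {0..} \<alpha>l_q \<circ> \<alpha>u_q \<circ> inv_into {0..} \<alpha>_q \<circ> (\<lambda>s. 10 * ?c s)) dbar) \<and>
          zeno_free (sampling_instant ?g \<gamma> U t0 T x))"
      if d: "d \<in> borel_measurable (lebesgue_on {t0..}) \<and> (\<forall>t\<ge>t0. d t \<in> D \<and> norm (d t) \<le> dbar)" for d
    proof -
      interpret sampled_loop f ?g D t0 dbar d Vq U \<alpha>l_w \<alpha>u_w \<alpha>_w \<sigma>_w \<zeta>_w \<alpha>l_q \<alpha>u_q \<alpha>_q \<sigma>_q \<zeta>_q \<gamma>
        using loop[OF dbar] d by blast
      have "norm (x t) \<le> inv_into {0..} \<alpha>l_q vstar"
        if "maximal_trajectory f ?g \<gamma> U d t0 T x" "x t0 = x0" "t0 + Vq x0 / ?c dbar \<le> t" for T x t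
        using maximal_trajectory_ultimate_bound[OF that(1)] that(2,3) by (simp add: c_def)
      moreover have "zeno_free (inst T x)" if "maximal_trajectory f ?g \<gamma> U d t0 T x" for T x
        using that by (intro traj_zeno_free) (simp add: maximal_trajectory_def)
      ultimately show ?thesis
        using maximal_trajectory_exists[of x0] maximal_trajectory_infinite
        by (auto simp: vstar_def c_def)
    qed
    ultimately show "\<exists>\<Delta>t\<ge>0. \<forall>d.
       d \<in> borel_measurable (lebesgue_on {t0..}) \<and> (\<forall>t\<ge>t0. d t \<in> D \<and> norm (d t) \<le> dbar) \<longrightarrow>
       (\<exists>T x. maximal_trajectory f ?g \<gamma> U d t0 T x \<and> x t0 = x0) \<and>
       (\<forall>T x. maximal_trajectory f ?g \<gamma> U d t0 T x \<and> x t0 = x0 \<longrightarrow>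
          T = \<infinity> \<and>
          (\<forall>t\<ge>t0 + \<Delta>t. norm (x t) \<le>
             (inv_into {0..} \<alpha>l_q \<circ> \<alpha>u_q \<circ> inv_into {0..} \<alpha>_q \<circ> (\<lambda>s. 10 * ?c s)) dbar) \<and>
          zeno_free (sampling_instant ?g \<gamma> U t0 T x))"
      by blast
  qed (use K in auto)
qed

end
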